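(* Let $\alpha>0$. There exist $\Psi_*\in L^2(A,\mathbb{C})$ and $t_*\in\overline{B_r(0)}^{\,N}$ with $$E_\alpha[\Psi_*,t_*]=\inf_{\Psi\in L^2(A,\mathbb{C}),\;t\in\overline{B_r(0)}^{\,N}}E_\alpha[\Psi,t].$$
   Context: A superscript $*$ on a function denotes complex conjugation, and $(\mathcal{F}h)(x)=\int h(y)e^{-2\pi i x\cdot y}\,\mathrm{d}y$ is the Fourier transform. Fix constants $\lambda>0$, $C_s\in\mathbb{R}$, $\alpha_{\max}>0$. Let $s\in L^1(\mathbb{R}^2,\mathbb{R})$ and $f\in L^1(\mathbb{R},\mathbb{R})$ be probability density functions. For $z\in\mathbb{R}$, $v\in\mathbb{R}^2$ (Euclidean norm $|v|$) put $\chi_z(v):=\frac12 z\lambda|v|^2+\frac14 C_s\lambda^3|v|^4$ and $p_z(v):=\exp(-2\pi i\chi_z(v))$. Let $A:=\{v\in\mathbb{R}^2:|v|<\alpha_{\max}/\lambda\}$ and let $a$ be the indicator function of $A$. For $Z\in\mathbb{R}$ let $$T_Z(v,w):=a(v)a^*(w)\int_{\mathbb{R}}\int_{\mathbb{R}^2}s(u)f(Z')\,p_{Z+Z'}(v+u)\,p_{Z+Z'}^*(w+u)\,\mathrm{d}u\,\mathrm{d}Z',\quad v,w\in\mathbb{R}^2.$$ The weighted cross-correlation of $\Psi,\Phi$ with weight $T$ is $(\Psi\star_{T}\Phi)(x):=\int_{\mathbb{R}^2}\Psi^*(y)\Phi(x+y)T(x+y,y)\,\mathrm{d}y$; functions in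 $L^2(A,\mathbb{C})$ are extended by zero to $\mathbb{R}^2$. Let $N\in\mathbb{N}$ and let $g_1,\ldots,g_N\in L^1(\mathbb{R}^2,\mathbb{R}_{\ge0})\cap L^2(\mathbb{R}^2,\mathbb{R}_{\ge0})$ satisfy $\operatorname{supp}(\mathcal{F}(g_j))\subseteq\overline{2A}$ for all $j$; let $Z_1,\ldots,Z_N\in\mathbb{R}$. With $\phi_y(x):=x+y$, define $$E:L^2(A,\mathbb{C})\times(\mathbb{R}^2)^N\to\mathbb{R},\quad E[\Psi,t]:=\frac1N\sum_{j=1}^N\big\|\Psi\star_{T_{Z_j}}\Psi-\mathcal{F}(g_j\circ\phi_{t_j})\big\|_{L^2}^2 .$$ Let $\Psi_M\in L^2(A,\mathbb{C})$, $r>0$, and let $B_r(0)\subseteq\mathbb{R}^2$ be the open ball of radius $r$ about $0$. For $\alpha>0$ the regularized functional is $$E_\alpha:L^2(A,\mathbb{C})\times\overline{B_r(0)}^{\,N}\to\mathbb{R},\quad E_\alpha[\Psi,t]:=E[\Psi,t]+\alpha\|\Psi-\Psi_M\|_{L^2}^2 .$$ *)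

theory Defs
  imports "HOL-Analysis.Analysis"
begin

(* Elements of L^1 and L^2 are represented by Borel functions; hypotheses on them are imposed
   almost everywhere. Elements of L^2(A) are extended by zero off A. *)

definition L2_space :: "'a::euclidean_space set \<Rightarrow> ('a \<Rightarrow> 'b::real_normed_vector) set" where
  "L2_space A = {h \<in> borel_measurable lborel.
     integrable lborel (\<lambda>x. (norm (h x))\<^sup>2) \<and> (\<forall>x. x \<notin> A \<longrightarrow> h x = 0)}"

(* Junk value 0 if h is not square integrable. *)
definition L2_norm :: "('a::euclidean_space \<Rightarrow> 'b::real_normed_vector) \<Rightarrow> real" where
  "L2_norm h = sqrt (LINT x|lborel. (norm (h x))\<^sup>2)"

definition probability_density :: "('a::euclidean_space \<Rightarrow> real) \<Rightarrow> bool" where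
  "probability_density h \<longleftrightarrow>
     integrable lborel h \<and> (AE x in lborel. 0 \<le> h x) \<and> (LINT x|lborel. h x) = 1"

definition fourier :: "('a::euclidean_space \<Rightarrow> complex) \<Rightarrow> 'a \<Rightarrow> complex" where
  "fourier h x = (LINT y|lborel. h y * exp (- 2 * of_real pi * \<i> * of_real (x \<bullet> y)))"

definition chi :: "real \<Rightarrow> real \<Rightarrow> real \<Rightarrow> real^2 \<Rightarrow> real" where
  "chi lam Cs z v = 1/2 * z * lam * (norm v)^2 + 1/4 * Cs * lam^3 * (norm v)^4"

definition phase :: "real \<Rightarrow> real \<Rightarrow> real \<Rightarrow> real^2 \<Rightarrow> complex" where
  "phase lam Cs z v = exp (- 2 * of_real pi * \<i> * of_real (chi lam Cs z v))"

definition aperture :: "real \<Rightarrow> real \<Rightarrow> (real^2) set" where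
  "aperture lam amax = {v. norm v < amax / lam}"

definition TCC ::
  "real \<Rightarrow> real \<Rightarrow> real \<Rightarrow> (real^2 \<Rightarrow> real) \<Rightarrow> (real \<Rightarrow> real) \<Rightarrow> real \<Rightarrow> real^2 \<Rightarrow> real^2 \<Rightarrow> complex"
where
  "TCC lam Cs amax s f Z v w =
     indicator (aperture lam amax) v * cnj (indicator (aperture lam amax) w) *
     (LINT Z'|lborel. (LINT u|lborel.
        of_real (s u) * of_real (f Z') *
        phase lam Cs (Z + Z') (v + u) * cnj (phase lam Cs (Z + Z') (w + u))))"

definition weighted_cross_correlation ::
  "(real^2 \<Rightarrow> real^2 \<Rightarrow> complex) \<Rightarrow> (real^2 \<Rightarrow> complex) \<Rightarrow> (real^2 \<Rightarrow> complex) \<Rightarrow> real^2 \<Rightarrow> complex"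
where
  "weighted_cross_correlation T \<Psi> \<Phi> x = (LINT y|lborel. cnj (\<Psi> y) * \<Phi> (x + y) * T (x + y) y)"

(* The index set {1,...,N} is the finite type 'n, with N = CARD('n) >= 1.
   For \<Psi> in L^2(A) and g j as in the theorem, both functions inside L2_norm are bounded with
   bounded support (by Cauchy-Schwarz, respectively the support condition), so the
   junk value of L2_norm does not occur. *)
definition E_data ::
  "real \<Rightarrow> real \<Rightarrow> real \<Rightarrow> (real^2 \<Rightarrow> real) \<Rightarrow> (real \<Rightarrow> real) \<Rightarrow> ('n::finite \<Rightarrow> real^2 \<Rightarrow> real) \<Rightarrow>
   ('n \<Rightarrow> real) \<Rightarrow> (real^2 \<Rightarrow> complex) \<Rightarrow> (real^2)^'n \<Rightarrow> real"
where
  "E_data lam Cs amax s f g Z \<Psi> t =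
     1 / real CARD('n) *
     (\<Sum>j\<in>UNIV. (L2_norm (\<lambda>x.
        weighted_cross_correlation (TCC lam Cs amax s f (Z j)) \<Psi> \<Psi> x
        - fourier (\<lambda>y. of_real (g j (y + t $ j))) x))\<^sup>2)"

definition E_reg ::
  "real \<Rightarrow> real \<Rightarrow> real \<Rightarrow> (real^2 \<Rightarrow> real) \<Rightarrow> (real \<Rightarrow> real) \<Rightarrow> ('n::finite \<Rightarrow> real^2 \<Rightarrow> real) \<Rightarrow>
   ('n \<Rightarrow> real) \<Rightarrow> (real^2 \<Rightarrow> complex) \<Rightarrow> real \<Rightarrow> (real^2 \<Rightarrow> complex) \<Rightarrow> (real^2)^'n \<Rightarrow> real"
where
  "E_reg lam Cs amax s f g Z \<Psi>M \<alpha> \<Psi> t =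
     E_data lam Cs amax s f g Z \<Psi> t + \<alpha> * (L2_norm (\<lambda>x. \<Psi> x - \<Psi>M x))\<^sup>2"

end

theory Submission
  imports Defs "HOL-Complex_Analysis.Great_Picard"
begin

text \<open>
  The proof is the direct method of the calculus of variations. Along a minimizing sequence
  \<open>(\<Psi>\<^sub>n, t\<^sub>n)\<close> the penalty \<open>\<alpha> \<parallel>\<Psi> - \<Psi>\<^sub>M\<parallel>\<^sup>2\<close> keeps \<open>\<Psi>\<^sub>n\<close> bounded in \<open>L\<^sup>2(A)\<close>,
  so after passing to a subsequence \<open>\<Psi>\<^sub>n\<close> converges weakly to some \<open>\<Psi>\<close>, and \<open>t\<^sub>n\<close> converges
  to some \<open>t\<close> because a product of closed balls is compact. It remains to see that the functional does
  not jump up in the limit (\<open>E_reg_weakly_lower_semicontinuous\<close>).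

  The difficulty is that \<open>\<Psi> \<mapsto> \<Psi> \<star>\<^sub>T \<Psi>\<close> is quadratic, and quadratic maps are in general not
  weakly continuous. What rescues the argument is the bounded aperture. Pairing
  \<open>\<Psi> \<star>\<^sub>T \<Psi>\<close> with a fixed function \<open>D\<close> and exchanging the integrals gives a quadratic form
  \<open>\<langle>\<Psi>, H\<^sub>D \<Psi>\<rangle>\<close>, where \<open>H\<^sub>D\<close> is the integral operator with kernel \<open>cnj (D (v - y)) T(v, y)\<close>. If
  \<open>D\<close> is bounded with bounded support, this kernel is square integrable on the relevant bounded set, so
  \<open>H\<^sub>D\<close> is a Hilbert--Schmidt operator and turns weak into strong convergence; hence the quadratic form is
  weakly continuous (\<open>inner_W_weakly_continuous\<close>). In other words, \<open>\<Psi>\<^sub>n \<star>\<^sub>T \<Psi>\<^sub>n\<close> converges weakly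
  to \<open>\<Psi> \<star>\<^sub>T \<Psi>\<close>. The functions \<open>D\<close> to be tested are the residuals
  \<open>\<Psi> \<star>\<^sub>T \<Psi> - \<F>(g \<circ> \<phi>\<^sub>t)\<close> of the limit: they are bounded, and the support condition on \<open>\<F>(g)\<close> makes
  them vanish outside a bounded set. The dependence on \<open>t\<close> is a mere modulation \<open>exp (2 \<pi> \<i> x \<bullet> t)\<close> of
  \<open>\<F>(g)\<close>, which dominated convergence handles. Lower semicontinuity then follows from the tangent
  inequality \<open>\<parallel>x\<parallel>\<^sup>2 \<ge> 2 (x \<bullet> y) - \<parallel>y\<parallel>\<^sup>2\<close> with \<open>y\<close> the limit residual.

  Weak compactness is derived in an arbitrary real Hilbert space from a Riesz representation
  argument (\<open>bounded_imp_weakly_convergent_subsequence\<close>). To apply it, square-integrable functions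
  modulo null sets are turned into a complete inner product space; complex-valued functions carry
  the real inner product \<open>Re (z cnj w)\<close>, which induces the same norm.
\<close>

section \<open>Weak sequential compactness in Hilbert spaces\<close>

text \<open>The representing vector is found variationally: a minimizing sequence in \<open>S\<close> of
  \<open>J x = \<parallel>x\<parallel>\<^sup>2 - 2 l x\<close> is Cauchy by the parallelogram identity, and the first variation of \<open>J\<close>
  vanishes at its limit. Since \<open>S\<close> is not assumed closed, the limit lies in the closure. For
  \<open>l x = h \<bullet> x\<close> the lemma yields the orthogonal projection of \<open>h\<close>, for \<open>S = UNIV\<close> the usual
  representation theorem; both cases are used below.\<close>
lemma riesz_on_subspace:
  fixes S :: "'a::{real_inner,complete_space} set" and l :: "'a \<Rightarrow> real"
  assumes S: "subspace S"
    and add: "\<And>x y. x \<in> S \<Longrightarrow> y \<in> S \<Longrightarrow> l (x + y) = l x + l y"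
    and scale: "\<And>c x. x \<in> S \<Longrightarrow> l (c *\<^sub>R x) = c * l x"
    and bound: "\<And>x. x \<in> S \<Longrightarrow> \<bar>l x\<bar> \<le> B * norm x"
  shows "\<exists>u \<in> closure S. \<forall>x\<in>S. l x = u \<bullet> x"
proof -
  define J where "J x = (norm x)\<^sup>2 - 2 * l x" for x
  define m where "m = Inf (J ` S)"
  have lower: "- B\<^sup>2 \<le> J x" if "x \<in> S" for x
  proof -
    have "0 \<le> (norm x - B)\<^sup>2" by simp
    then show ?thesis
      using bound[OF that] unfolding J_def power2_diff by (simp add: mult.commute)
  qed
  have bdd: "bdd_below (J ` S)" using lower by (auto intro!: bdd_belowI2[of _ "- B\<^sup>2"])
  have ne: "J ` S \<noteq> {}" using subspace_0[OF S] by auto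
  have m_le: "m \<le> J x" if "x \<in> S" for x
    unfolding m_def using bdd that by (auto intro: cInf_lower)
  have "\<exists>x\<in>S. J x < m + 1 / real (Suc n)" for n
    using cInf_lessD[OF ne, of "m + 1 / real (Suc n)"] by (auto simp: m_def)
  then obtain x where xS: "\<And>n. x n \<in> S" and xJ: "\<And>n. J (x n) < m + 1 / real (Suc n)"
    by metis
  have close: "(norm (x i - x j))\<^sup>2 \<le> 2 / real (Suc i) + 2 / real (Suc j)" for i j
  proof -
    have mid: "(1/2) *\<^sub>R (x i + x j) \<in> S"
      by (intro subspace_scale[OF S] subspace_add[OF S] xS)
    have "l ((1/2) *\<^sub>R (x i + x j)) = 1/2 * (l (x i) + l (x j))"
      using scale[OF subspace_add[OF S xS[of i] xS[of j]], of "1/2"] add[OF xS xS, of i j] by simp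
    then have "(norm (x i - x j))\<^sup>2 = 2 * (J (x i) + J (x j) - 2 * J ((1/2) *\<^sub>R (x i + x j)))"
      by (simp add: J_def power2_norm_eq_inner inner_diff inner_add inner_commute field_simps)
    also have "\<dots> \<le> 2 * (1 / real (Suc i) + 1 / real (Suc j))"
    proof (rule mult_left_mono)
      show "J (x i) + J (x j) - 2 * J ((1/2) *\<^sub>R (x i + x j)) \<le> 1 / real (Suc i) + 1 / real (Suc j)"
        using add_mono[OF less_imp_le[OF xJ[of i]] less_imp_le[OF xJ[of j]]] m_le[OF mid]
        by argo
    qed simp
    finally show ?thesis by simp
  qed
  have "Cauchy x"
  proof (rule CauchyI)
    fix e :: real assume e: "e > 0"
    obtain N where N: "4 / e\<^sup>2 < real N" using reals_Archimedean2 by blast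
    have "norm (x i - x j) < e" if "i \<ge> N" "j \<ge> N" for i j
    proof -
      have small: "2 / real (Suc k) < e\<^sup>2 / 2" if "k \<ge> N" for k
      proof -
        have "4 / e\<^sup>2 < real (Suc k)" using N that by linarith
        then show ?thesis using e by (simp add: field_simps)
      qed
      have "(norm (x i - x j))\<^sup>2 < e\<^sup>2"
        using close[of i j] small[OF that(1)] small[OF that(2)] by argo
      then show ?thesis using e by (simp add: power_less_imp_less_base)
    qed
    then show "\<exists>M. \<forall>m\<ge>M. \<forall>n\<ge>M. norm (x m - x n) < e" by blast
  qed
  then obtain u where u: "x \<longlonglongrightarrow> u" using Cauchy_convergent convergentD by blast
  have Jm: "(\<lambda>n. J (x n)) \<longlonglongrightarrow> m"
  proof (rule tendsto_sandwich[of "\<lambda>_. m" _ _ "\<lambda>n. m + 1 / real (Suc n)"])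
    show "(\<lambda>n. m + 1 / real (Suc n)) \<longlonglongrightarrow> m"
      using tendsto_add[OF tendsto_const LIMSEQ_inverse_real_of_nat, of m]
      by (simp add: inverse_eq_divide)
  qed (use m_le xS xJ in \<open>auto intro!: always_eventually less_imp_le\<close>)
  have "l v = u \<bullet> v" if v: "v \<in> S" for v
  proof -
    have ineq: "0 \<le> 2 * c * (u \<bullet> v - l v) + c\<^sup>2 * (norm v)\<^sup>2" for c
    proof -
      have J_exp: "J (x n + c *\<^sub>R v) = J (x n) + (2 * c * (x n \<bullet> v - l v) + c\<^sup>2 * (norm v)\<^sup>2)" for n
      proof -
        have "(norm (x n + c *\<^sub>R v))\<^sup>2 = (norm (x n))\<^sup>2 + 2 * c * (x n \<bullet> v) + c\<^sup>2 * (norm v)\<^sup>2"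
          unfolding power2_norm_eq_inner
          by (simp add: inner_add inner_commute power2_eq_square algebra_simps)
        then show ?thesis
          unfolding J_def using add[OF xS[of n] subspace_scale[OF S v], of c] scale[OF v, of c]
          by (simp add: algebra_simps)
      qed
      have "(\<lambda>n. J (x n + c *\<^sub>R v)) \<longlonglongrightarrow> m + (2 * c * (u \<bullet> v - l v) + c\<^sup>2 * (norm v)\<^sup>2)"
        unfolding J_exp by (intro tendsto_intros Jm u)
      moreover have "m \<le> J (x n + c *\<^sub>R v)" for n
        by (intro m_le subspace_add[OF S] subspace_scale[OF S] xS v)
      ultimately have "m \<le> m + (2 * c * (u \<bullet> v - l v) + c\<^sup>2 * (norm v)\<^sup>2)"
        by (intro LIMSEQ_le_const) auto
      then show ?thesis by simp
    qed
    show ?thesis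
    proof (rule ccontr)
      assume "l v \<noteq> u \<bullet> v"
      \<comment> \<open>The choice \<open>c = - d / q\<close> minimizes \<open>2 c d + c\<^sup>2 q\<close>; the summand 1 in \<open>q\<close> covers \<open>v = 0\<close>.\<close>
      define q where "q = (norm v)\<^sup>2 + 1"
      define d where "d = u \<bullet> v - l v"
      have q: "q > 0" unfolding q_def by (simp add: add_nonneg_pos)
      have "0 \<le> 2 * (- d / q) * d + (- d / q)\<^sup>2 * (q - 1)"
        using ineq[of "- d / q"] by (simp add: q_def d_def)
      also have "\<dots> = - (d\<^sup>2 / q) - (d / q)\<^sup>2"
        using q by (simp add: field_simps power2_eq_square)
      also have "\<dots> < 0" using \<open>l v \<noteq> u \<bullet> v\<close> q unfolding d_def
        by (smt (verit) divide_pos_pos zero_less_power2 zero_le_power2)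
      finally show False by simp
    qed
  qed
  moreover have "u \<in> closure S" using xS u closure_sequential by blast
  ultimately show ?thesis by blast
qed

text \<open>A diagonal argument makes \<open>X (r n) \<bullet> X k\<close> converge for every \<open>k\<close>, hence \<open>X (r n) \<bullet> h\<close> for all \<open>h\<close> in
  the closed span of the sequence. Every other \<open>h\<close> may be replaced by its projection to this span,
  since the difference is orthogonal to all \<open>X n\<close>. The limit functional is represented by a vector, the weak limit.\<close>
theorem bounded_imp_weakly_convergent_subsequence:
  fixes X :: "nat \<Rightarrow> 'a::{real_inner,complete_space}"
  assumes bdd: "\<And>n. norm (X n) \<le> B"
  shows "\<exists>r x. strict_mono r \<and> (\<forall>h. (\<lambda>n. X (r n) \<bullet> h) \<longlonglongrightarrow> x \<bullet> h)"
proof -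
  have B0: "0 \<le> B" using bdd[of 0] norm_ge_zero order_trans by blast
  have CS: "\<bar>X n \<bullet> h\<bar> \<le> B * norm h" for n h
    using Cauchy_Schwarz_ineq2[of "X n" h] mult_right_mono[OF bdd[of n], of "norm h"] by simp
  have "norm (X n \<bullet> X k) \<le> B * B" for n k
    using CS[of n "X k"] mult_left_mono[OF bdd[of k] B0] by simp
  from function_convergent_subsequence[of "UNIV :: nat set" "\<lambda>n k. X n \<bullet> X k" "B * B", OF _ this]
  obtain r where r: "strict_mono r" and conv: "\<And>k. convergent (\<lambda>n. X (r n) \<bullet> X k)"
    unfolding convergent_def by auto
  define S where "S = span (range X)"
  have S: "subspace S" unfolding S_def by (rule subspace_span)
  have conv_S: "convergent (\<lambda>n. X (r n) \<bullet> h)" if "h \<in> S" for h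
    using that unfolding S_def
  proof (rule span_induct)
    show "subspace {h. convergent (\<lambda>n. X (r n) \<bullet> h)}"
      unfolding subspace_def 
      by (auto simp: inner_add_right intro!: convergent_add convergent_mult convergent_const)
  qed (use conv in auto)
  have conv_closure: "convergent (\<lambda>n. X (r n) \<bullet> p)" if p: "p \<in> closure S" for p
  proof (rule Cauchy_convergent, rule CauchyI)
    fix e :: real assume e: "e > 0"
    define d where "d = e / (4 * (B + 1))"
    have d: "d > 0" using e B0 by (simp add: d_def)
    obtain q where q: "q \<in> S" "dist q p < d" using p d unfolding closure_approachable by blast
    have near: "\<bar>X n \<bullet> p - X n \<bullet> q\<bar> \<le> e / 4" for n
    proof -
      have "\<bar>X n \<bullet> (p - q)\<bar> \<le> B * norm (p - q)" by (rule CS)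
      also have "\<dots> \<le> (B + 1) * d"
        using q B0 by (intro mult_mono) (auto simp: dist_norm norm_minus_commute)
      also have "\<dots> = e / 4" using B0 by (simp add: d_def field_simps)
      finally show ?thesis by (simp add: inner_diff_right)
    qed
    have "Cauchy (\<lambda>n. X (r n) \<bullet> q)" using conv_S[OF q(1)] convergent_Cauchy by blast
    then obtain M where "\<And>m n. m \<ge> M \<Longrightarrow> n \<ge> M \<Longrightarrow> norm (X (r m) \<bullet> q - X (r n) \<bullet> q) < e / 4"
      using e by (meson CauchyD divide_pos_pos zero_less_numeral)
    then have "norm (X (r m) \<bullet> p - X (r n) \<bullet> p) < e" if "m \<ge> M" "n \<ge> M" for m n
      using near[of "r m"] near[of "r n"] that by (fastforce simp: real_norm_def abs_if split: if_splits)
    then show "\<exists>M. \<forall>m\<ge>M. \<forall>n\<ge>M. norm (X (r m) \<bullet> p - X (r n) \<bullet> p) < e" by blast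
  qed
  have conv_all: "convergent (\<lambda>n. X (r n) \<bullet> h)" for h
  proof -
    obtain p where p: "p \<in> closure S" "\<And>x. x \<in> S \<Longrightarrow> h \<bullet> x = p \<bullet> x"
      using riesz_on_subspace[OF S, of "\<lambda>x. h \<bullet> x" "norm h"]
      by (auto simp: inner_add_right Cauchy_Schwarz_ineq2)
    have "X (r n) \<bullet> h = X (r n) \<bullet> p" for n
      using p(2)[of "X (r n)"] by (auto simp: S_def span_base inner_commute)
    then show ?thesis using conv_closure[OF p(1)] by simp
  qed
  define l where "l h = lim (\<lambda>n. X (r n) \<bullet> h)" for h
  have l: "(\<lambda>n. X (r n) \<bullet> h) \<longlonglongrightarrow> l h" for h
    unfolding l_def using conv_all convergent_LIMSEQ_iff by blast
  have "\<exists>u\<in>closure UNIV. \<forall>h\<in>UNIV. l h = u \<bullet> h"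
  proof (rule riesz_on_subspace)
    show "l (x + y) = l x + l y" for x y
      using LIMSEQ_unique[OF l[of "x + y"]] tendsto_add[OF l[of x] l[of y]]
      by (simp add: inner_add_right)
    show "l (c *\<^sub>R x) = c * l x" for c x
      using LIMSEQ_unique[OF l[of "c *\<^sub>R x"]] tendsto_mult_left[OF l[of x], of c] by simp
    show "\<bar>l x\<bar> \<le> B * norm x" for x
      using tendsto_rabs[OF l[of x]] CS by (intro LIMSEQ_le_const2) auto
  qed auto
  then show ?thesis using r l by force
qed

lemma tendsto_inner_weak_strong:
  fixes X Y :: "nat \<Rightarrow> 'a::real_inner"
  assumes bdd: "\<And>n. norm (X n) \<le> B"
    and weak: "\<And>h. (\<lambda>n. X n \<bullet> h) \<longlonglongrightarrow> x \<bullet> h" and strong: "Y \<longlonglongrightarrow> y"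
  shows "(\<lambda>n. X n \<bullet> Y n) \<longlonglongrightarrow> x \<bullet> y"
proof -
  have B0: "0 \<le> B" using bdd[of 0] norm_ge_zero order_trans by blast
  have "(\<lambda>n. X n \<bullet> (Y n - y)) \<longlonglongrightarrow> 0"
  proof (rule Lim_null_comparison)
    show "\<forall>\<^sub>F n in sequentially. norm (X n \<bullet> (Y n - y)) \<le> B * norm (Y n - y)"
      by (auto intro!: always_eventually order_trans[OF Cauchy_Schwarz_ineq2] mult_right_mono bdd)
    show "(\<lambda>n. B * norm (Y n - y)) \<longlonglongrightarrow> 0"
      using tendsto_mult_right_zero[OF tendsto_norm_zero[OF LIM_zero[OF strong]]] .
  qed
  from tendsto_add[OF this weak[of y]] show ?thesis by (simp add: inner_diff_right)
qed

section \<open>The Hilbert space of square-integrable functions\<close>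

lemma L2_spaceD:
  assumes "f \<in> L2_space A"
  shows "f \<in> borel_measurable borel" "integrable lborel (\<lambda>x. (norm (f x))\<^sup>2)"
    "\<And>x. x \<notin> A \<Longrightarrow> f x = 0"
  using assms by (auto simp: L2_space_def)

lemma L2_space_mono: "f \<in> L2_space A \<Longrightarrow> A \<subseteq> B \<Longrightarrow> f \<in> L2_space B"
  by (auto simp: L2_space_def)

lemma L2_space_of_dominated:
  fixes f :: "'a::euclidean_space \<Rightarrow> 'b::euclidean_space"
  assumes [measurable]: "f \<in> borel_measurable borel" and g: "integrable lborel g"
    and "\<And>x. (norm (f x))\<^sup>2 \<le> g x" and "\<And>x. x \<notin> A \<Longrightarrow> f x = 0"
  shows "f \<in> L2_space A"
proof -
  have "norm ((norm (f x))\<^sup>2) \<le> norm (g x)" for x using assms(3)[of x] by simp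
  then have "integrable lborel (\<lambda>x. (norm (f x))\<^sup>2)"
    by (intro Bochner_Integration.integrable_bound[OF g] AE_I2) auto
  then show ?thesis using assms(1,4) by (simp add: L2_space_def)
qed

lemma L2_space_add:
  fixes f g :: "'a::euclidean_space \<Rightarrow> 'b::euclidean_space"
  assumes f: "f \<in> L2_space A" and g: "g \<in> L2_space A"
  shows "(\<lambda>x. f x + g x) \<in> L2_space A"
proof (rule L2_space_of_dominated)
  show "integrable lborel (\<lambda>x. 2 * (norm (f x))\<^sup>2 + 2 * (norm (g x))\<^sup>2)"
    using L2_spaceD(2)[OF f] L2_spaceD(2)[OF g] by auto
  show "(norm (f x + g x))\<^sup>2 \<le> 2 * (norm (f x))\<^sup>2 + 2 * (norm (g x))\<^sup>2" for x
    using power_mono[OF norm_triangle_ineq[of "f x" "g x"], of 2]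
      sum_squares_bound[of "norm (f x)" "norm (g x)"] by (simp add: power2_sum)
qed (use L2_spaceD[OF f] L2_spaceD[OF g] in \<open>auto\<close>)

lemma L2_space_scaleR:
  fixes f :: "'a::euclidean_space \<Rightarrow> 'b::euclidean_space"
  assumes f: "f \<in> L2_space A" shows "(\<lambda>x. c *\<^sub>R f x) \<in> L2_space A"
  by (rule L2_space_of_dominated[of _ "\<lambda>x. c\<^sup>2 * (norm (f x))\<^sup>2"])
     (use L2_spaceD[OF f] in \<open>auto simp: power_mult_distrib\<close>)

lemma L2_space_diff:
  fixes f g :: "'a::euclidean_space \<Rightarrow> 'b::euclidean_space"
  assumes "f \<in> L2_space A" and "g \<in> L2_space A"
  shows "(\<lambda>x. f x - g x) \<in> L2_space A"
  using L2_space_add[OF assms(1) L2_space_scaleR[OF assms(2), of "-1"]] by simp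

lemma L2_space_zero: "(\<lambda>x. 0) \<in> L2_space A"
  by (simp add: L2_space_def)

lemma integrable_inner_L2:
  fixes f g :: "'a::euclidean_space \<Rightarrow> 'b::euclidean_space"
  assumes f: "f \<in> L2_space UNIV" and g: "g \<in> L2_space UNIV"
  shows "integrable lborel (\<lambda>x. f x \<bullet> g x)"
proof (rule Bochner_Integration.integrable_bound)
  show "integrable lborel (\<lambda>x. (norm (f x))\<^sup>2 + (norm (g x))\<^sup>2)"
    using L2_spaceD(2)[OF f] L2_spaceD(2)[OF g] by auto
  show "(\<lambda>x. f x \<bullet> g x) \<in> borel_measurable lborel"
    using L2_spaceD(1)[OF f] L2_spaceD(1)[OF g] by auto
  have "\<bar>f x \<bullet> g x\<bar> \<le> (norm (f x))\<^sup>2 + (norm (g x))\<^sup>2" for x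
    using Cauchy_Schwarz_ineq2[of "f x" "g x"] sum_squares_bound[of "norm (f x)" "norm (g x)"]
      mult_nonneg_nonneg[OF norm_ge_zero norm_ge_zero, of "f x" "g x"] by linarith
  then show "AE x in lborel. norm (f x \<bullet> g x) \<le> norm ((norm (f x))\<^sup>2 + (norm (g x))\<^sup>2)"
    by (auto intro!: AE_I2)
qed

definition L2_eq :: "('a::euclidean_space \<Rightarrow> 'b::euclidean_space) \<Rightarrow> ('a \<Rightarrow> 'b) \<Rightarrow> bool" where
  "L2_eq f g \<longleftrightarrow> f \<in> L2_space UNIV \<and> g \<in> L2_space UNIV \<and> (AE x in lborel. f x = g x)"

lemma L2_eq_refl [simp]: "L2_eq f f \<longleftrightarrow> f \<in> L2_space UNIV"
  by (auto simp: L2_eq_def)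

text \<open>Identifying functions that agree almost everywhere makes the inner product definite, so that the
  results on Hilbert spaces as a type class apply. The relation is reflexive exactly on the
  square-integrable functions; hence the quotient is partial.\<close>
quotient_type (overloaded) ('a, 'b) L2 = "'a::euclidean_space \<Rightarrow> 'b::euclidean_space" / partial: L2_eq
proof (rule part_equivpI)
  show "\<exists>x. L2_eq (x :: 'a \<Rightarrow> 'b) x" using L2_space_zero by auto
  show "symp (L2_eq :: ('a \<Rightarrow> 'b) \<Rightarrow> _)"
    by (rule sympI) (auto simp: L2_eq_def eq_commute)
  show "transp (L2_eq :: ('a \<Rightarrow> 'b) \<Rightarrow> _)"
    by (rule transpI) (auto simp: L2_eq_def elim: AE_mp)
qed

lemma abs_L2_eq_iff:
  assumes "f \<in> L2_space UNIV" "g \<in> L2_space UNIV"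
  shows "abs_L2 f = abs_L2 g \<longleftrightarrow> (AE x in lborel. f x = g x)"
  using Quotient_rel[OF Quotient_L2, of f g] assms by (auto simp: L2_eq_def)

lemma L2_cases [cases type: L2]:
  obtains f where "f \<in> L2_space UNIV" "u = abs_L2 f"
  using Quotient_abs_rep[OF Quotient_L2, of u] Quotient_rep_reflp[OF Quotient_L2, of u]
  by (metis L2_eq_refl)

instantiation L2 :: (euclidean_space, euclidean_space) real_vector
begin

lift_definition zero_L2 :: "('a, 'b) L2" is "\<lambda>_. 0"
  by (simp add: L2_space_zero)

lift_definition plus_L2 :: "('a, 'b) L2 \<Rightarrow> ('a, 'b) L2 \<Rightarrow> ('a, 'b) L2" is "\<lambda>f g x. f x + g x"
  by (auto simp: L2_eq_def L2_space_add elim: AE_mp)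

lift_definition minus_L2 :: "('a, 'b) L2 \<Rightarrow> ('a, 'b) L2 \<Rightarrow> ('a, 'b) L2" is "\<lambda>f g x. f x - g x"
  by (auto simp: L2_eq_def L2_space_diff elim: AE_mp)

lift_definition uminus_L2 :: "('a, 'b) L2 \<Rightarrow> ('a, 'b) L2" is "\<lambda>f x. - f x"
  using L2_space_scaleR[of _ UNIV "-1"] by (auto simp: L2_eq_def elim: AE_mp)

lift_definition scaleR_L2 :: "real \<Rightarrow> ('a, 'b) L2 \<Rightarrow> ('a, 'b) L2" is "\<lambda>c f x. c *\<^sub>R f x"
  by (auto simp: L2_eq_def L2_space_scaleR elim: AE_mp)

lemmas L2_ops = plus_L2.abs_eq minus_L2.abs_eq uminus_L2.abs_eq scaleR_L2.abs_eq
  L2_space_add L2_space_diff L2_space_scaleR L2_space_zero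

instance
proof
  fix u v w :: "('a, 'b) L2" and a b :: real
  have neg: "(\<lambda>x. - f x) \<in> L2_space UNIV" if "f \<in> L2_space UNIV" for f :: "'a \<Rightarrow> 'b"
    using L2_space_scaleR[OF that, of "-1"] by simp
  show "u + v + w = u + (v + w)"
    by (cases u; cases v; cases w) (simp add: L2_ops add.assoc)
  show "u + v = v + u" by (cases u; cases v) (simp add: L2_ops add.commute)
  show "0 + u = u" by (cases u) (simp add: L2_ops zero_L2_def)
  show "- u + u = 0" by (cases u) (simp add: L2_ops zero_L2_def neg)
  show "u - v = u + - v" by (cases u; cases v) (simp add: L2_ops neg)
  show "a *\<^sub>R (u + v) = a *\<^sub>R u + a *\<^sub>R v"
    by (cases u; cases v) (simp add: L2_ops scaleR_add_right)
  show "(a + b) *\<^sub>R u = a *\<^sub>R u + b *\<^sub>R u" by (cases u) (simp add: L2_ops scaleR_add_left)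
  show "a *\<^sub>R b *\<^sub>R u = (a * b) *\<^sub>R u" by (cases u) (simp add: L2_ops)
  show "1 *\<^sub>R u = u" by (cases u) (simp add: L2_ops)
qed

end

instantiation L2 :: (euclidean_space, euclidean_space) real_inner
begin

lift_definition inner_L2 :: "('a, 'b) L2 \<Rightarrow> ('a, 'b) L2 \<Rightarrow> real"
  is "\<lambda>f g. LINT x|lborel. f x \<bullet> g x"
proof -
  fix f f' g g' :: "'a \<Rightarrow> 'b"
  assume "L2_eq f f'" "L2_eq g g'"
  then show "(LINT x|lborel. f x \<bullet> g x) = (LINT x|lborel. f' x \<bullet> g' x)"
    by (intro integral_cong_AE) (auto simp: L2_eq_def L2_space_def elim: AE_mp)
qed

definition norm_L2 :: "('a, 'b) L2 \<Rightarrow> real" where "norm_L2 u = sqrt (u \<bullet> u)"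
definition dist_L2 :: "('a, 'b) L2 \<Rightarrow> ('a, 'b) L2 \<Rightarrow> real" where "dist_L2 u v = norm (u - v)"
definition sgn_L2 :: "('a, 'b) L2 \<Rightarrow> ('a, 'b) L2" where "sgn_L2 u = u /\<^sub>R norm u"
definition uniformity_L2 :: "(('a, 'b) L2 \<times> ('a, 'b) L2) filter" where
  "uniformity_L2 = (INF e\<in>{0<..}. principal {(u, v). dist u v < e})"
definition open_L2 :: "('a, 'b) L2 set \<Rightarrow> bool" where
  "open_L2 U \<longleftrightarrow> (\<forall>u\<in>U. \<forall>\<^sub>F (u', v) in uniformity. u' = u \<longrightarrow> v \<in> U)"

lemma inner_abs_L2:
  "f \<in> L2_space UNIV \<Longrightarrow> g \<in> L2_space UNIV \<Longrightarrow> abs_L2 f \<bullet> abs_L2 g = (LINT x|lborel. f x \<bullet> g x)"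
  for f g :: "'a \<Rightarrow> 'b"
  by (simp add: inner_L2.abs_eq)

instance
proof
  fix u v w :: "('a, 'b) L2" and a :: real and U :: "('a, 'b) L2 set"
  show "u \<bullet> v = v \<bullet> u" by (cases u; cases v) (simp add: inner_abs_L2 inner_commute)
  show "(u + v) \<bullet> w = u \<bullet> w + v \<bullet> w"
    by (cases u; cases v; cases w) (simp add: inner_abs_L2 L2_ops inner_add_left integrable_inner_L2)
  show "a *\<^sub>R u \<bullet> v = a * (u \<bullet> v)" by (cases u; cases v) (simp add: inner_abs_L2 L2_ops)
  show "0 \<le> u \<bullet> u" by (cases u) (simp add: inner_abs_L2)
  show "u \<bullet> u = 0 \<longleftrightarrow> u = 0"
  proof (cases u)
    fix f assume f: "f \<in> L2_space UNIV" "u = abs_L2 f"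
    have "u \<bullet> u = 0 \<longleftrightarrow> (AE x in lborel. f x \<bullet> f x = 0)"
      unfolding f(2) inner_abs_L2[OF f(1) f(1)]
      by (rule integral_nonneg_eq_0_iff_AE) (auto intro: integrable_inner_L2 f)
    then show ?thesis
      unfolding f(2) zero_L2_def using abs_L2_eq_iff[OF f(1) L2_space_zero] by simp
  qed
qed (simp_all add: norm_L2_def dist_L2_def sgn_L2_def uniformity_L2_def open_L2_def)

end

lemma norm_abs_L2: "f \<in> L2_space UNIV \<Longrightarrow> norm (abs_L2 f) = L2_norm f"
  by (simp add: norm_L2_def inner_abs_L2 L2_norm_def power2_norm_eq_inner)

lemma L2_norm_power2: "f \<in> L2_space UNIV \<Longrightarrow> (L2_norm f)\<^sup>2 = (LINT x|lborel. (norm (f x))\<^sup>2)"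
  by (simp add: L2_norm_def)

lemma nn_integral_eq_L2_norm:
  "f \<in> L2_space UNIV \<Longrightarrow> (\<integral>\<^sup>+ x. ennreal ((norm (f x))\<^sup>2) \<partial>lborel) = ennreal ((L2_norm f)\<^sup>2)"
  by (subst nn_integral_eq_integral) (auto simp: L2_norm_power2 L2_spaceD)

text \<open>Geometrically small increments are what turns convergence in norm into almost everywhere convergence in
  the next lemma.\<close>
lemma Cauchy_rapid_subsequence:
  fixes X :: "nat \<Rightarrow> 'a::metric_space"
  assumes "Cauchy X"
  shows "\<exists>r. strict_mono r \<and> (\<forall>k. dist (X (r (Suc k))) (X (r k)) < (1/2) ^ k)"
proof -
  have "\<exists>N. \<forall>i\<ge>N. \<forall>j\<ge>N. dist (X i) (X j) < (1/2) ^ k" for k :: nat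
    using metric_CauchyD[OF assms, of "(1/2) ^ k"] by auto
  then obtain N where N: "\<And>k i j. i \<ge> N k \<Longrightarrow> j \<ge> N k \<Longrightarrow> dist (X i) (X j) < (1/2) ^ (k::nat)"
    by metis
  obtain r where r: "\<And>k. N k \<le> r k" "\<And>k. r k < r (Suc k)"
    using dependent_nat_choice[of "\<lambda>k n. N k \<le> n" "\<lambda>_ m n. m < n"]
    by (metis le_add2 less_eq_Suc_le max.cobounded1 max.cobounded2 le_refl)
  have "dist (X (r (Suc k))) (X (r k)) < (1/2) ^ k" for k
    using r(1)[of k] r(2)[of k] by (intro N) auto
  then show ?thesis using r(2) by (auto simp: strict_mono_Suc_iff)
qed

text \<open>With \<open>u\<^sub>k = |F\<^sub>k\<^sub>+\<^sub>1 - F\<^sub>k|\<close> the weighted series \<open>\<Sum> 2\<^sup>k u\<^sub>k\<^sup>2\<close> has finite integral, so it converges almost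
  everywhere, and \<open>u\<^sub>k \<le> 2\<^sup>k u\<^sub>k\<^sup>2 + 2\<^sup>-\<^sup>k\<close> makes \<open>\<Sum> u\<^sub>k\<close> converge there as well.\<close>
lemma AE_convergent_of_rapid_L2:
  fixes F :: "nat \<Rightarrow> 'a::euclidean_space \<Rightarrow> 'b::euclidean_space"
  assumes F: "\<And>k. F k \<in> L2_space UNIV"
    and rapid: "\<And>k. L2_norm (\<lambda>x. F (Suc k) x - F k x) \<le> (1/2) ^ k"
  shows "AE x in lborel. convergent (\<lambda>k. F k x)"
proof -
  note [measurable] = L2_spaceD(1)[OF F]
  define u where "u k x = norm (F (Suc k) x - F k x)" for k x
  have int: "(\<integral>\<^sup>+ x. ennreal (2 ^ k * (u k x)\<^sup>2) \<partial>lborel) \<le> ennreal ((1/2) ^ k)" for k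
  proof -
    have "(\<integral>\<^sup>+ x. ennreal (2 ^ k * (u k x)\<^sup>2) \<partial>lborel)
        = ennreal (2 ^ k) * (\<integral>\<^sup>+ x. ennreal ((u k x)\<^sup>2) \<partial>lborel)"
      unfolding u_def by (subst nn_integral_cmult[symmetric]) (auto simp: ennreal_mult)
    also have "\<dots> = ennreal (2 ^ k * (L2_norm (\<lambda>x. F (Suc k) x - F k x))\<^sup>2)"
      unfolding u_def by (subst nn_integral_eq_L2_norm) (auto simp: L2_space_diff F ennreal_mult)
    also have "\<dots> \<le> ennreal (2 ^ k * ((1/2) ^ k)\<^sup>2)"
      using rapid[of k] by (intro ennreal_leI mult_left_mono power_mono) (auto simp: L2_norm_def)
    also have "2 ^ k * ((1/2) ^ k)\<^sup>2 = (1/2 :: real) ^ k"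
      by (simp add: power2_eq_square power_mult_distrib[symmetric] flip: mult.assoc)
    finally show ?thesis .
  qed
  have "(\<integral>\<^sup>+ x. (\<Sum>k. ennreal (2 ^ k * (u k x)\<^sup>2)) \<partial>lborel)
      = (\<Sum>k. \<integral>\<^sup>+ x. ennreal (2 ^ k * (u k x)\<^sup>2) \<partial>lborel)"
    unfolding u_def by (rule nn_integral_suminf) auto
  also have "\<dots> \<le> (\<Sum>k. ennreal ((1/2) ^ k))"
    by (intro suminf_le int) auto
  also have "\<dots> = ennreal (\<Sum>k. (1/2) ^ k)"
    by (rule suminf_ennreal2) (auto simp: summable_geometric)
  also have "\<dots> < \<infinity>" by simp
  finally have "AE x in lborel. (\<Sum>k. ennreal (2 ^ k * (u k x)\<^sup>2)) \<noteq> \<infinity>"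
    by (intro nn_integral_noteq_infinite) (auto simp: u_def)
  then show ?thesis
  proof (rule AE_mp, intro AE_I2 impI)
    fix x assume "(\<Sum>k. ennreal (2 ^ k * (u k x)\<^sup>2)) \<noteq> \<infinity>"
    then have "summable (\<lambda>k. 2 ^ k * (u k x)\<^sup>2)"
      by (intro summable_suminf_not_top) auto
    then have "summable (\<lambda>k. 2 ^ k * (u k x)\<^sup>2 + (1/2) ^ k)"
      by (intro summable_add) (auto simp: summable_geometric)
    then have "summable (\<lambda>k. F (Suc k) x - F k x)"
    proof (rule summable_comparison_test'[where N = 0])
      fix k
      have "u k x \<le> 2 ^ k * (u k x)\<^sup>2 + (1/2) ^ k"
      proof (cases "u k x \<le> (1/2) ^ k")
        case False
        then have "1 * u k x \<le> (2 ^ k * u k x) * u k x"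
          by (intro mult_right_mono) (auto simp: u_def field_simps power_one_over)
        then show ?thesis by (simp add: power2_eq_square mult.assoc add_increasing2)
      qed (simp add: add_increasing)
      then show "norm (F (Suc k) x - F k x) \<le> 2 ^ k * (u k x)\<^sup>2 + (1/2) ^ k"
        by (simp add: u_def)
    qed
    then have "convergent (\<lambda>n. \<Sum>k<n. F (Suc k) x - F k x)"
      by (simp add: summable_iff_convergent)
    then have "convergent (\<lambda>n. F n x - F 0 x)"
      unfolding sum_lessThan_telescope[of "\<lambda>k. F k x"] .
    then show "convergent (\<lambda>n. F n x)"
      using convergent_add[OF _ convergent_const, of "\<lambda>n. F n x - F 0 x" "F 0 x"] by simp
  qed
qed

text \<open>The Riesz--Fischer theorem: the almost everywhere limit of a rapidly convergent subsequence is the limit in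
  norm, by Fatou's lemma applied to \<open>|F\<^sub>m - F\<^sub>k|\<^sup>2\<close> as \<open>m\<close> tends to infinity.\<close>
instance L2 :: (euclidean_space, euclidean_space) complete_space
proof
  fix X :: "nat \<Rightarrow> ('a, 'b) L2"
  assume X: "Cauchy X"
  have "\<exists>f. f \<in> L2_space UNIV \<and> X n = abs_L2 f" for n by (cases "X n") auto
  then obtain f where f: "\<And>n. f n \<in> L2_space UNIV" "\<And>n. X n = abs_L2 (f n)" by metis
  have dist_X: "dist (X i) (X j) = L2_norm (\<lambda>x. f i x - f j x)" for i j
    by (simp add: dist_norm f L2_ops norm_abs_L2)
  obtain r where r: "strict_mono r" "\<And>k. dist (X (r (Suc k))) (X (r k)) < (1/2) ^ k"
    using Cauchy_rapid_subsequence[OF X] by blast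
  define F where "F k = f (r k)" for k
  have F: "F k \<in> L2_space UNIV" for k by (simp add: F_def f)
  note [measurable] = L2_spaceD(1)[OF F]
  define g where "g x = lim (\<lambda>k. F k x)" for x
  have [measurable]: "g \<in> borel_measurable borel" unfolding g_def by measurable
  have AE_lim: "AE x in lborel. (\<lambda>k. F k x) \<longlonglongrightarrow> g x"
    using AE_convergent_of_rapid_L2[of F] F r(2) unfolding dist_X F_def[symmetric] g_def
    by (auto simp: convergent_LIMSEQ_iff less_imp_le)
  have Fatou: "(\<lambda>x. g x - F k x) \<in> L2_space UNIV \<and> L2_norm (\<lambda>x. g x - F k x) \<le> e"
    if e: "0 \<le> e" and tail: "\<And>m. m \<ge> k \<Longrightarrow> dist (X (r m)) (X (r k)) \<le> e" for k e
  proof -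
    have "(\<integral>\<^sup>+ x. ennreal ((norm (g x - F k x))\<^sup>2) \<partial>lborel)
        = (\<integral>\<^sup>+ x. liminf (\<lambda>m. ennreal ((norm (F m x - F k x))\<^sup>2)) \<partial>lborel)"
    proof (rule nn_integral_cong_AE, rule AE_mp[OF AE_lim], intro AE_I2 impI)
      fix x assume "(\<lambda>k. F k x) \<longlonglongrightarrow> g x"
      then have "(\<lambda>m. ennreal ((norm (F m x - F k x))\<^sup>2)) \<longlonglongrightarrow> ennreal ((norm (g x - F k x))\<^sup>2)"
        by (intro tendsto_intros tendsto_ennrealI)
      then show "ennreal ((norm (g x - F k x))\<^sup>2)
          = liminf (\<lambda>m. ennreal ((norm (F m x - F k x))\<^sup>2))"
        by (intro lim_imp_Liminf[symmetric]) auto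
    qed
    also have "\<dots> \<le> liminf (\<lambda>m. \<integral>\<^sup>+ x. ennreal ((norm (F m x - F k x))\<^sup>2) \<partial>lborel)"
      by (rule nn_integral_liminf) auto
    also have "\<dots> = liminf (\<lambda>m. ennreal ((dist (X (r m)) (X (r k)))\<^sup>2))"
      unfolding dist_X F_def[symmetric] by (subst nn_integral_eq_L2_norm) (auto simp: F L2_space_diff)
    also have "\<dots> \<le> limsup (\<lambda>m. ennreal ((dist (X (r m)) (X (r k)))\<^sup>2))"
      by (rule Liminf_le_Limsup) simp
    also have "\<dots> \<le> ennreal (e\<^sup>2)"
      using tail by (intro Limsup_bounded eventually_sequentiallyI[of k] ennreal_leI power_mono) auto
    finally have le: "(\<integral>\<^sup>+ x. ennreal ((norm (g x - F k x))\<^sup>2) \<partial>lborel) \<le> ennreal (e\<^sup>2)" .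
    then have mem: "(\<lambda>x. g x - F k x) \<in> L2_space UNIV"
      unfolding L2_space_def
      by (auto intro!: integrableI_bounded le_less_trans[OF le])
    from le have "(L2_norm (\<lambda>x. g x - F k x))\<^sup>2 \<le> e\<^sup>2"
      using e by (simp add: nn_integral_eq_L2_norm[OF mem])
    then have "L2_norm (\<lambda>x. g x - F k x) \<le> e" using e by (rule power2_le_imp_le)
    with mem show ?thesis by simp
  qed
  have tail: "\<exists>K. \<forall>k\<ge>K. \<forall>m\<ge>k. dist (X (r m)) (X (r k)) \<le> e" if e: "e > 0" for e
  proof -
    obtain K where K: "\<And>i j. i \<ge> K \<Longrightarrow> j \<ge> K \<Longrightarrow> dist (X i) (X j) < e"
      using metric_CauchyD[OF X e] by blast
    then have "dist (X (r m)) (X (r k)) \<le> e" if "k \<ge> K" "m \<ge> k" for k m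
      using seq_suble[OF r(1), of k] seq_suble[OF r(1), of m] that
      by (intro less_imp_le[OF K]) auto
    then show ?thesis by blast
  qed
  obtain K where "\<And>m. m \<ge> K \<Longrightarrow> dist (X (r m)) (X (r K)) \<le> 1"
    using tail[of 1] by auto
  then have "(\<lambda>x. (g x - F K x) + F K x) \<in> L2_space UNIV"
    using Fatou[of 1 K] by (intro L2_space_add F) auto
  then have g: "g \<in> L2_space UNIV" by simp
  have "(X \<circ> r) \<longlonglongrightarrow> abs_L2 g"
  proof (rule metric_LIMSEQ_I)
    fix e :: real assume e: "e > 0"
    then obtain K where K: "\<And>k m. k \<ge> K \<Longrightarrow> m \<ge> k \<Longrightarrow> dist (X (r m)) (X (r k)) \<le> e / 2"
      using tail[of "e/2"] by auto
    have "dist ((X \<circ> r) k) (abs_L2 g) < e" if "k \<ge> K" for k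
    proof -
      have "dist ((X \<circ> r) k) (abs_L2 g) = L2_norm (\<lambda>x. g x - F k x)"
        by (subst dist_commute) (simp add: dist_norm f g F_def L2_ops norm_abs_L2)
      also have "\<dots> < e" using Fatou[of "e/2" k] K that e by auto
      finally show ?thesis .
    qed
    then show "\<exists>K. \<forall>k\<ge>K. dist ((X \<circ> r) k) (abs_L2 g) < e" by blast
  qed
  then show "convergent X"
    using Cauchy_converges_subseq[OF X r(1)] convergentI by blast
qed

section \<open>Weak convergence of square-integrable functions\<close>

lemma borel_measurable_cnj [measurable (raw)]:
  "f \<in> borel_measurable M \<Longrightarrow> (\<lambda>x. cnj (f x)) \<in> borel_measurable M"
  by (rule borel_measurable_continuous_on[OF _ _]) (auto intro: continuous_intros)

lemma L2_space_bounded_support: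
  fixes f :: "'a::euclidean_space \<Rightarrow> 'b::euclidean_space"
  assumes "f \<in> borel_measurable borel" and K: "\<And>x. norm (f x) \<le> K"
    and supp: "\<And>x. norm x > r \<Longrightarrow> f x = 0"
  shows "f \<in> L2_space UNIV"
proof (rule L2_space_of_dominated)
  show "integrable lborel (\<lambda>x. K\<^sup>2 * indicator (cball 0 r) x :: real)"
    by (intro integrable_mult_right integrable_real_indicator) (use emeasure_bounded_finite[OF bounded_cball, of 0 r] in auto)
  show "(norm (f x))\<^sup>2 \<le> K\<^sup>2 * indicator (cball 0 r) x" for x
    using power_mono[OF K[of x], of 2] supp[of x] by (auto simp: indicator_def not_le)
qed (use assms(1) in auto)

text \<open>On a bounded set \<open>|f| \<le> 1 + |f|\<^sup>2\<close> suffices; the resulting bound on the integral is uniform on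
  norm-bounded families.\<close>
lemma L2_space_bounded_set_imp_L1:
  fixes f :: "'a::euclidean_space \<Rightarrow> 'b::euclidean_space"
  assumes f: "f \<in> L2_space (ball 0 R)"
  shows "integrable lborel f"
    and "(LINT x|lborel. norm (f x)) \<le> measure lborel (ball (0::'a) R) + (L2_norm f)\<^sup>2"
proof -
  have [measurable]: "f \<in> borel_measurable borel" using L2_spaceD[OF f] by simp
  have g: "integrable lborel (\<lambda>x. indicator (ball 0 R) x + (norm (f x))\<^sup>2)"
    using L2_spaceD(2)[OF f]
    by (intro Bochner_Integration.integrable_add integrable_real_indicator)
       (use emeasure_bounded_finite[OF bounded_ball, of 0 R] in auto)
  have le: "norm (f x) \<le> indicator (ball 0 R) x + (norm (f x))\<^sup>2" for x
  proof (cases "x \<in> ball 0 R")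
    case True
    have "2 * norm (f x) \<le> (norm (f x))\<^sup>2 + 1"
      using sum_squares_bound[of "norm (f x)" 1] by simp
    then have "norm (f x) \<le> 1 + (norm (f x))\<^sup>2"
      using norm_ge_zero[of "f x"] zero_le_power2[of "norm (f x)"] by linarith
    then show ?thesis using True by simp
  qed (use L2_spaceD(3)[OF f] in auto)
  show int: "integrable lborel f"
  proof (rule Bochner_Integration.integrable_bound[OF g])
    show "AE x in lborel. norm (f x) \<le> norm (indicator (ball 0 R) x + (norm (f x))\<^sup>2)"
      using le by (intro AE_I2) (auto intro: order_trans[OF _ abs_ge_self])
  qed simp
  have "(LINT x|lborel. norm (f x)) \<le> (LINT x|lborel. indicator (ball 0 R) x + (norm (f x))\<^sup>2)"
    by (intro integral_mono integrable_norm int g le)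
  also have "\<dots> = measure lborel (ball (0::'a) R) + (L2_norm f)\<^sup>2"
    using L2_spaceD(2)[OF f]
    by (subst Bochner_Integration.integral_add)
       (use emeasure_bounded_finite[OF bounded_ball, of 0 R] in
        \<open>auto simp: L2_norm_def intro!: integrable_real_indicator\<close>)
  finally show "(LINT x|lborel. norm (f x)) \<le> measure lborel (ball (0::'a) R) + (L2_norm f)\<^sup>2" .
qed

lemma lborel_integral_translate:
  fixes f :: "'a::euclidean_space \<Rightarrow> 'b::{banach,second_countable_topology}"
  assumes [measurable]: "f \<in> borel_measurable borel"
  shows "(LINT x|lborel. f (c + x)) = (LINT x|lborel. f x)"
    and "integrable lborel (\<lambda>x. f (c + x)) \<longleftrightarrow> integrable lborel f"
  using integral_distr[of "(+) c" lborel borel f] integrable_distr_eq[of "(+) c" lborel borel f]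
  by (simp_all add: lborel_distr_plus)

text \<open>Weak convergence is kept at the level of functions, since pointwise values and supports matter in
  the applications.\<close>
definition weakly_tendsto ::
  "(nat \<Rightarrow> 'a::euclidean_space \<Rightarrow> 'b::euclidean_space) \<Rightarrow> ('a \<Rightarrow> 'b) \<Rightarrow> bool" where
  "weakly_tendsto F f \<longleftrightarrow> (\<forall>h \<in> L2_space UNIV.
     (\<lambda>n. LINT x|lborel. F n x \<bullet> h x) \<longlonglongrightarrow> (LINT x|lborel. f x \<bullet> h x))"

text \<open>The Hilbert space theorem provides a weak limit on the whole space; cutting it off outside \<open>A\<close> does not
  change any of the limits, because the members of the sequence vanish there.\<close>
lemma L2_bounded_imp_weakly_convergent_subsequence:
  fixes F :: "nat \<Rightarrow> 'a::euclidean_space \<Rightarrow> 'b::euclidean_space"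
  assumes F: "\<And>n. F n \<in> L2_space A" and bdd: "\<And>n. L2_norm (F n) \<le> B"
    and A [measurable]: "A \<in> sets borel"
  shows "\<exists>r f. strict_mono r \<and> f \<in> L2_space A \<and> weakly_tendsto (F \<circ> r) f"
proof -
  have F': "F n \<in> L2_space UNIV" for n using L2_space_mono[OF F] by blast
  have "norm (abs_L2 (F n)) \<le> B" for n using bdd by (simp add: norm_abs_L2 F')
  from bounded_imp_weakly_convergent_subsequence[of "\<lambda>n. abs_L2 (F n)", OF this]
  obtain r x where r: "strict_mono r" and x: "\<And>h. (\<lambda>n. abs_L2 (F (r n)) \<bullet> h) \<longlonglongrightarrow> x \<bullet> h"
    by blast
  obtain p where p: "p \<in> L2_space UNIV" "x = abs_L2 p" by (cases x)
  have cut: "(\<lambda>x. indicator A x *\<^sub>R h x) \<in> L2_space A" if h: "h \<in> L2_space UNIV" for h :: "'a \<Rightarrow> 'b"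
    by (rule L2_space_of_dominated[OF _ L2_spaceD(2)[OF h]])
       (use L2_spaceD[OF h] in \<open>auto simp: indicator_def\<close>)
  define f where "f x = indicator A x *\<^sub>R p x" for x
  have "weakly_tendsto (F \<circ> r) f"
    unfolding weakly_tendsto_def
  proof
    fix h :: "'a \<Rightarrow> 'b" assume h: "h \<in> L2_space UNIV"
    have h': "(\<lambda>x. indicator A x *\<^sub>R h x) \<in> L2_space UNIV"
      using L2_space_mono[OF cut[OF h]] by blast
    have "(\<lambda>n. LINT x|lborel. F (r n) x \<bullet> indicator A x *\<^sub>R h x)
        \<longlonglongrightarrow> (LINT x|lborel. p x \<bullet> indicator A x *\<^sub>R h x)"
      using x[of "abs_L2 (\<lambda>x. indicator A x *\<^sub>R h x)"] by (simp add: p inner_abs_L2 F' h')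
    moreover have "F n x \<bullet> indicator A x *\<^sub>R h x = F n x \<bullet> h x" for n x
      using L2_spaceD(3)[OF F[of n]] by (cases "x \<in> A") auto
    moreover have "p x \<bullet> indicator A x *\<^sub>R h x = f x \<bullet> h x" for x by (simp add: f_def)
    ultimately show "(\<lambda>n. LINT x|lborel. (F \<circ> r) n x \<bullet> h x) \<longlonglongrightarrow> (LINT x|lborel. f x \<bullet> h x)"
      by (simp del: inner_scaleR_right)
  qed
  moreover have "f \<in> L2_space A" unfolding f_def by (rule cut[OF p(1)])
  ultimately show ?thesis using r by blast
qed

text \<open>Weak convergence is formulated with the real inner product. Testing with \<open>cnj k\<close> and \<open>\<i> cnj k\<close> recovers the
  real and imaginary parts of the complex pairing.\<close>
lemma weakly_tendsto_mult:
  fixes F :: "nat \<Rightarrow> 'a::euclidean_space \<Rightarrow> complex"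
  assumes weak: "weakly_tendsto F f" and k: "k \<in> L2_space UNIV"
    and F: "\<And>n. integrable lborel (\<lambda>x. k x * F n x)" and f: "integrable lborel (\<lambda>x. k x * f x)"
  shows "(\<lambda>n. LINT x|lborel. k x * F n x) \<longlonglongrightarrow> (LINT x|lborel. k x * f x)"
proof -
  have [measurable]: "k \<in> borel_measurable borel" using L2_spaceD[OF k] by simp
  have mem: "(\<lambda>x. c * cnj (k x)) \<in> L2_space UNIV" for c
    by (rule L2_space_of_dominated[of _ "\<lambda>x. (norm c)\<^sup>2 * (norm (k x))\<^sup>2"])
       (use L2_spaceD(2)[OF k] in \<open>auto simp: norm_mult power_mult_distrib\<close>)
  have lim: "(\<lambda>n. LINT x|lborel. F n x \<bullet> (c * cnj (k x))) \<longlonglongrightarrow> (LINT x|lborel. f x \<bullet> (c * cnj (k x)))" for c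
    using bspec[OF weak[unfolded weakly_tendsto_def] mem[of c]] .
  have re: "Re (k x * z) = z \<bullet> (1 * cnj (k x))" for x z
    by (simp add: inner_complex_def algebra_simps)
  have im: "Im (k x * z) = z \<bullet> (\<i> * cnj (k x))" for x z
    by (simp add: inner_complex_def algebra_simps)
  have "(\<lambda>n. Re (LINT x|lborel. k x * F n x)) \<longlonglongrightarrow> Re (LINT x|lborel. k x * f x)"
    using lim[of 1] by (simp only: integral_Re[OF F, symmetric] integral_Re[OF f, symmetric] re)
  moreover have "(\<lambda>n. Im (LINT x|lborel. k x * F n x)) \<longlonglongrightarrow> Im (LINT x|lborel. k x * f x)"
    using lim[of "\<i>"] by (simp only: integral_Im[OF F, symmetric] integral_Im[OF f, symmetric] im)
  ultimately show ?thesis by (simp add: tendsto_complex_iff)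
qed

section \<open>Weak continuity of weighted autocorrelations\<close>

locale bounded_kernel =
  fixes T :: "real^2 \<Rightarrow> real^2 \<Rightarrow> complex" and C :: real
  assumes T_measurable: "(\<lambda>z. T (fst z) (snd z)) \<in> borel_measurable (borel \<Otimes>\<^sub>M borel)"
    and T_bounded: "norm (T v w) \<le> C"
begin

lemma T_compose [measurable (raw)]:
  assumes [measurable]: "f \<in> borel_measurable M" "g \<in> borel_measurable M"
  shows "(\<lambda>z. T (f z) (g z)) \<in> borel_measurable M"
proof -
  have "(\<lambda>z. (f z, g z)) \<in> M \<rightarrow>\<^sub>M borel \<Otimes>\<^sub>M borel" by measurable
  from measurable_compose[OF this T_measurable] show ?thesis by simp
qed

lemma C_nonneg: "0 \<le> C" using T_bounded[of 0 0] norm_ge_zero order_trans by blast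

abbreviation W :: "(real^2 \<Rightarrow> complex) \<Rightarrow> real^2 \<Rightarrow> complex" where
  "W \<Psi> \<equiv> weighted_cross_correlation T \<Psi> \<Psi>"

lemma W_measurable [measurable (raw)]:
  assumes [measurable]: "\<Psi> \<in> borel_measurable borel"
  shows "W \<Psi> \<in> borel_measurable borel"
  unfolding weighted_cross_correlation_def by measurable

lemma W_support:
  assumes \<Psi>: "\<Psi> \<in> L2_space (ball 0 R)" and x: "norm x \<ge> 2 * R"
  shows "W \<Psi> x = 0"
proof -
  have "cnj (\<Psi> y) * \<Psi> (x + y) * T (x + y) y = 0" for y
  proof (cases "norm y < R")
    case True
    then have "norm (x + y) \<ge> R" using x norm_diff_ineq[of x y] by linarith
    then show ?thesis using L2_spaceD(3)[OF \<Psi>, of "x + y"] by simp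
  qed (use L2_spaceD(3)[OF \<Psi>, of y] in simp)
  then show ?thesis by (simp only: weighted_cross_correlation_def Bochner_Integration.integral_zero)
qed

lemma W_bounded:
  assumes \<Psi>: "\<Psi> \<in> L2_space UNIV"
  shows "norm (W \<Psi> x) \<le> 2 * C * (L2_norm \<Psi>)\<^sup>2"
proof -
  have [measurable]: "\<Psi> \<in> borel_measurable borel" using L2_spaceD[OF \<Psi>] by simp
  have tr: "integrable lborel (\<lambda>y. (norm (\<Psi> (x + y)))\<^sup>2)"
    "(LINT y|lborel. (norm (\<Psi> (x + y)))\<^sup>2) = (LINT y|lborel. (norm (\<Psi> y))\<^sup>2)"
    using lborel_integral_translate[of "\<lambda>y. (norm (\<Psi> y))\<^sup>2" x] L2_spaceD(2)[OF \<Psi>] by auto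
  have int: "integrable lborel (\<lambda>y. C * ((norm (\<Psi> y))\<^sup>2 + (norm (\<Psi> (x + y)))\<^sup>2))"
    using tr L2_spaceD(2)[OF \<Psi>] by auto
  have le: "norm (cnj (\<Psi> y) * \<Psi> (x + y) * T (x + y) y)
      \<le> C * ((norm (\<Psi> y))\<^sup>2 + (norm (\<Psi> (x + y)))\<^sup>2)" for y
  proof -
    have "norm (\<Psi> y) * norm (\<Psi> (x + y)) \<le> (norm (\<Psi> y))\<^sup>2 + (norm (\<Psi> (x + y)))\<^sup>2"
      using sum_squares_bound[of "norm (\<Psi> y)" "norm (\<Psi> (x + y))"]
        mult_nonneg_nonneg[OF norm_ge_zero norm_ge_zero, of "\<Psi> y" "\<Psi> (x + y)"] by linarith
    from mult_mono[OF this T_bounded[of "x + y" y]] show ?thesis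
      by (simp add: norm_mult mult.commute)
  qed
  have "norm (W \<Psi> x) \<le> (LINT y|lborel. norm (cnj (\<Psi> y) * \<Psi> (x + y) * T (x + y) y))"
    unfolding weighted_cross_correlation_def by (rule integral_norm_bound)
  also have "\<dots> \<le> (LINT y|lborel. C * ((norm (\<Psi> y))\<^sup>2 + (norm (\<Psi> (x + y)))\<^sup>2))"
  proof (rule integral_mono[OF _ int le])
    have "integrable lborel (\<lambda>y. cnj (\<Psi> y) * \<Psi> (x + y) * T (x + y) y)"
      by (rule Bochner_Integration.integrable_bound[OF int])
         (auto intro!: AE_I2 order_trans[OF le abs_ge_self])
    then show "integrable lborel (\<lambda>y. norm (cnj (\<Psi> y) * \<Psi> (x + y) * T (x + y) y))"
      by (rule integrable_norm)
  qed
  also have "\<dots> = 2 * C * (L2_norm \<Psi>)\<^sup>2"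
    using tr L2_spaceD(2)[OF \<Psi>] by (simp add: L2_norm_def)
  finally show ?thesis .
qed

text \<open>The Hilbert--Schmidt operator \<open>H\<^sub>D\<close> that represents the pairing of \<open>W \<Psi>\<close> with \<open>D\<close>, see
  \<open>inner_W_eq_inner_corr_op\<close> below.\<close>
definition corr_op :: "(real^2 \<Rightarrow> complex) \<Rightarrow> (real^2 \<Rightarrow> complex) \<Rightarrow> real^2 \<Rightarrow> complex" where
  "corr_op D \<Psi> y = (LINT v|lborel. cnj (D (v - y)) * T v y * \<Psi> v)"

lemma corr_op_measurable [measurable (raw)]:
  assumes [measurable]: "D \<in> borel_measurable borel" "\<Psi> \<in> borel_measurable borel"
  shows "corr_op D \<Psi> \<in> borel_measurable borel"
  unfolding corr_op_def by measurable

context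
  fixes D :: "real^2 \<Rightarrow> complex" and Q q :: real
  assumes D_meas [measurable]: "D \<in> borel_measurable borel"
    and D_bounded: "\<And>x. norm (D x) \<le> Q" and D_support: "\<And>x. norm x > q \<Longrightarrow> D x = 0"
begin

lemma Q_nonneg: "0 \<le> Q" using D_bounded[of 0] norm_ge_zero order_trans by blast

lemma kernel_bounded: "norm (cnj (D x) * T v w) \<le> Q * C"
  unfolding norm_mult complex_mod_cnj by (intro mult_mono D_bounded T_bounded Q_nonneg) auto

lemma integrable_kernel:
  assumes \<Psi>: "integrable lborel \<Psi>"
  shows "integrable lborel (\<lambda>v. cnj (D (v - y)) * T v y * \<Psi> v)"
proof (rule Bochner_Integration.integrable_bound)
  have [measurable]: "\<Psi> \<in> borel_measurable borel" using borel_measurable_integrable[OF \<Psi>] by simp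
  show "integrable lborel (\<lambda>v. Q * C * norm (\<Psi> v))" using \<Psi> by auto
  show "AE v in lborel. norm (cnj (D (v - y)) * T v y * \<Psi> v) \<le> norm (Q * C * norm (\<Psi> v))"
    using mult_right_mono[OF kernel_bounded norm_ge_zero]
    by (auto simp: norm_mult intro!: AE_I2 order_trans[OF _ abs_ge_self])
  show "(\<lambda>v. cnj (D (v - y)) * T v y * \<Psi> v) \<in> borel_measurable lborel" by measurable
qed

lemma corr_op_bounded:
  assumes \<Psi>: "integrable lborel \<Psi>"
  shows "norm (corr_op D \<Psi> y) \<le> Q * C * (LINT v|lborel. norm (\<Psi> v))"
proof -
  have "norm (corr_op D \<Psi> y) \<le> (LINT v|lborel. norm (cnj (D (v - y)) * T v y * \<Psi> v))"
    unfolding corr_op_def by (rule integral_norm_bound)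
  also have "\<dots> \<le> (LINT v|lborel. Q * C * norm (\<Psi> v))"
    unfolding norm_mult[of "cnj _ * _"]
    by (intro integral_mono mult_right_mono[OF kernel_bounded norm_ge_zero])
       (use \<Psi> integrable_norm[OF integrable_kernel[OF \<Psi>]] in \<open>auto simp: norm_mult\<close>)
  finally show ?thesis by simp
qed

lemma corr_op_support:
  assumes \<Psi>: "\<Psi> \<in> L2_space (ball 0 R)" and y: "norm y > q + R"
  shows "corr_op D \<Psi> y = 0"
proof -
  have "cnj (D (v - y)) * T v y * \<Psi> v = 0" for v
  proof (cases "norm v < R")
    case True
    then have "norm (v - y) > q" using y norm_triangle_ineq2[of y v] norm_minus_commute[of v y] by linarith
    then show ?thesis by (simp add: D_support)
  qed (use L2_spaceD(3)[OF \<Psi>, of v] in simp)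
  then show ?thesis by (simp only: corr_op_def Bochner_Integration.integral_zero)
qed

lemma corr_op_in_L2:
  assumes \<Psi>: "\<Psi> \<in> L2_space (ball 0 R)" shows "corr_op D \<Psi> \<in> L2_space UNIV"
proof (rule L2_space_bounded_support[OF _ corr_op_bounded corr_op_support[OF \<Psi>]])
  show "corr_op D \<Psi> \<in> borel_measurable borel"
    using L2_spaceD(1)[OF \<Psi>] by measurable
qed (rule L2_space_bounded_set_imp_L1(1)[OF \<Psi>])

text \<open>Fubini's theorem and the substitution \<open>v = x + y\<close>. Integrability on the product space follows by
  integrating first over \<open>x\<close>: the inner integral of the absolute value is at most
  \<open>|\<Psi> y|\<close> times a constant multiple of the \<open>L\<^sup>1\<close> norm of \<open>\<Psi>\<close>.\<close>
lemma inner_W_eq_inner_corr_op: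
  assumes \<Psi>: "\<Psi> \<in> L2_space (ball 0 R)"
  shows "(LINT x|lborel. W \<Psi> x \<bullet> D x) = (LINT y|lborel. \<Psi> y \<bullet> corr_op D \<Psi> y)"
proof -
  have [measurable]: "\<Psi> \<in> borel_measurable borel" using L2_spaceD[OF \<Psi>] by simp
  note L1 = L2_space_bounded_set_imp_L1(1)[OF \<Psi>]
  define G where "G y x = cnj (\<Psi> y) * (cnj (D x) * T (x + y) y * \<Psi> (x + y))" for y x
  have shift: "(LINT x|lborel. cnj (D x) * T (x + y) y * \<Psi> (x + y)) = corr_op D \<Psi> y"
    "integrable lborel (\<lambda>x. cnj (D x) * T (x + y) y * \<Psi> (x + y))"
    "(LINT x|lborel. norm (cnj (D x) * T (x + y) y * \<Psi> (x + y)))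
      = (LINT v|lborel. norm (cnj (D (v - y)) * T v y * \<Psi> v))" for y
    using lborel_integral_translate[of "\<lambda>v. cnj (D (v - y)) * T v y * \<Psi> v" y]
      lborel_integral_translate(1)[of "\<lambda>v. norm (cnj (D (v - y)) * T v y * \<Psi> v)" y]
      integrable_kernel[OF L1, of y]
    by (simp_all add: corr_op_def add.commute)
  have G_meas [measurable]: "(\<lambda>z. G (fst z) (snd z)) \<in> borel_measurable (borel \<Otimes>\<^sub>M borel)"
    unfolding G_def by measurable
  have G_int: "integrable (lborel \<Otimes>\<^sub>M lborel) (\<lambda>(y, x). G y x)"
  proof (rule lborel_pair.Fubini_integrable)
    show "(\<lambda>(y, x). G y x) \<in> borel_measurable (lborel \<Otimes>\<^sub>M lborel)"
      using G_meas by (simp add: split_beta')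
    have "integrable lborel (\<lambda>y. LINT x|lborel. norm (G y x))"
    proof (rule Bochner_Integration.integrable_bound)
      show "integrable lborel (\<lambda>y. norm (\<Psi> y) * (Q * C * (LINT v|lborel. norm (\<Psi> v))))"
        using L1 by auto
      show "(\<lambda>y. LINT x|lborel. norm (G y x)) \<in> borel_measurable lborel"
        by measurable
      have "(LINT x|lborel. norm (G y x)) \<le> norm (\<Psi> y) * (Q * C * (LINT v|lborel. norm (\<Psi> v)))" for y
      proof -
        have "(LINT x|lborel. norm (G y x))
            = norm (\<Psi> y) * (LINT v|lborel. norm (cnj (D (v - y)) * T v y * \<Psi> v))"
          unfolding G_def norm_mult[of "cnj (\<Psi> _)"] shift(3)[symmetric] by simp
        also have "(LINT v|lborel. norm (cnj (D (v - y)) * T v y * \<Psi> v))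
            \<le> (LINT v|lborel. Q * C * norm (\<Psi> v))"
          unfolding norm_mult[of "cnj _ * _"]
          by (intro integral_mono mult_right_mono[OF kernel_bounded norm_ge_zero])
             (use L1 integrable_norm[OF integrable_kernel[OF L1]] in \<open>auto simp: norm_mult\<close>)
        finally show ?thesis by (simp add: mult_left_mono)
      qed
      then show "AE y in lborel. norm (LINT x|lborel. norm (G y x))
          \<le> norm (norm (\<Psi> y) * (Q * C * (LINT v|lborel. norm (\<Psi> v))))"
        by (auto intro!: AE_I2 order_trans[OF _ abs_ge_self])
    qed
    then show "integrable lborel (\<lambda>y. LINT x|lborel. norm (case (y, x) of (y, x) \<Rightarrow> G y x))" by simp
    show "AE y in lborel. integrable lborel (\<lambda>x. case (y, x) of (y, x) \<Rightarrow> G y x)"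
      unfolding G_def using shift(2) by auto
  qed
  have W_eq: "(LINT y|lborel. G y x) = cnj (D x) * W \<Psi> x" for x
    unfolding G_def weighted_cross_correlation_def integral_mult_right_zero[symmetric]
    by (intro Bochner_Integration.integral_cong refl) (simp add: ac_simps)
  have corr_op_eq: "(LINT x|lborel. G y x) = cnj (\<Psi> y) * corr_op D \<Psi> y" for y
    unfolding G_def by (simp add: shift(1))
  have "integrable lborel (\<lambda>x. LINT y|lborel. G y x)"
    using lborel_pair.integrable_snd[of G] G_int by simp
  then have intW: "integrable lborel (\<lambda>x. cnj (D x) * W \<Psi> x)" unfolding W_eq .
  have "integrable lborel (\<lambda>y. LINT x|lborel. G y x)"
    using lborel_pair.integrable_fst[of G] G_int by simp
  then have int_op: "integrable lborel (\<lambda>y. cnj (\<Psi> y) * corr_op D \<Psi> y)" unfolding corr_op_eq .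
  have inner_eq: "a \<bullet> b = Re (cnj b * a)" "a \<bullet> b = Re (cnj a * b)" for a b :: complex
    by (simp_all add: inner_complex_def algebra_simps)
  have "(LINT x|lborel. W \<Psi> x \<bullet> D x) = Re (LINT x|lborel. cnj (D x) * W \<Psi> x)"
    unfolding inner_eq(1) by (rule integral_Re[OF intW])
  also have "(LINT x|lborel. cnj (D x) * W \<Psi> x) = (LINT y|lborel. cnj (\<Psi> y) * corr_op D \<Psi> y)"
    using lborel_pair.Fubini_integral[OF G_int] unfolding W_eq corr_op_eq .
  also have "Re \<dots> = (LINT y|lborel. \<Psi> y \<bullet> corr_op D \<Psi> y)"
    unfolding inner_eq(2) by (rule integral_Re[OF int_op, symmetric])
  finally show ?thesis .
qed

text \<open>The operator \<open>H\<^sub>D\<close> is compact in the following concrete sense. For fixed \<open>y\<close> the value \<open>H\<^sub>D \<Psi> y\<close> is a pairing of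
  \<open>\<Psi>\<close> with a square-integrable function, so it converges along weakly convergent sequences. The values are
  uniformly bounded and vanish outside a fixed ball, so dominated convergence yields convergence of
  \<open>H\<^sub>D (F n)\<close> in norm. The inner product of a bounded weakly convergent and a strongly convergent sequence
  converges.\<close>
lemma inner_W_weakly_continuous:
  assumes F: "\<And>n. F n \<in> L2_space (ball 0 R)" and f: "f \<in> L2_space (ball 0 R)"
    and bdd: "\<And>n. L2_norm (F n) \<le> B" and weak: "weakly_tendsto F f"
  shows "(\<lambda>n. LINT x|lborel. W (F n) x \<bullet> D x) \<longlonglongrightarrow> (LINT x|lborel. W f x \<bullet> D x)"
proof -
  note F1 = L2_space_bounded_set_imp_L1[OF F] and f1 = L2_space_bounded_set_imp_L1[OF f]
  have F': "F n \<in> L2_space UNIV" and f': "f \<in> L2_space UNIV" for n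
    using L2_space_mono[OF F] L2_space_mono[OF f] by blast+
  define M where "M = Q * C * (measure lborel (ball (0::real^2) R) + B\<^sup>2)"
  have corr_op_le: "norm (corr_op D (F n) y) \<le> M" for n y
  proof -
    have "(L2_norm (F n))\<^sup>2 \<le> B\<^sup>2" using bdd by (intro power_mono) (auto simp: L2_norm_def)
    then have "Q * C * (LINT v|lborel. norm (F n v)) \<le> M"
      unfolding M_def using F1(2)[of n] Q_nonneg C_nonneg by (intro mult_left_mono) auto
    then show ?thesis using corr_op_bounded[OF F1(1)] order_trans by blast
  qed
  have ptw: "(\<lambda>n. corr_op D (F n) y) \<longlonglongrightarrow> corr_op D f y" for y
    unfolding corr_op_def
  proof (rule weakly_tendsto_mult[OF weak])
    show "(\<lambda>v. cnj (D (v - y)) * T v y) \<in> L2_space UNIV"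
    proof (rule L2_space_bounded_support[OF _ kernel_bounded])
      fix v :: "real^2" assume "norm v > q + norm y"
      then have "norm (v - y) > q" using norm_triangle_ineq2[of v y] by linarith
      then show "cnj (D (v - y)) * T v y = 0" by (simp add: D_support)
    qed measurable
  qed (intro integrable_kernel F1 f1)+
  have opF: "corr_op D (F n) \<in> L2_space UNIV" and opf: "corr_op D f \<in> L2_space UNIV" for n
    using corr_op_in_L2 F f by auto
  note [measurable] = L2_spaceD(1)[OF opF] L2_spaceD(1)[OF opf]
  have "(\<lambda>n. LINT y|lborel. (norm (corr_op D (F n) y - corr_op D f y))\<^sup>2) \<longlonglongrightarrow> (LINT y|(lborel :: (real^2) measure). 0)"
  proof (rule integral_dominated_convergence
      [where w = "\<lambda>y. (M + M)\<^sup>2 * indicator (cball (0::real^2) (q + R)) y"])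
    show "integrable lborel (\<lambda>y. (M + M)\<^sup>2 * indicator (cball (0::real^2) (q + R)) y :: real)"
      by (intro integrable_mult_right integrable_real_indicator)
         (use emeasure_bounded_finite[OF bounded_cball, of 0 "q + R"] in auto)
    have lim: "(\<lambda>n. (norm (corr_op D (F n) y - corr_op D f y))\<^sup>2) \<longlonglongrightarrow> 0" for y
      using tendsto_power[OF tendsto_norm_zero[OF LIM_zero[OF ptw[of y]]], of 2] by simp
    show "AE y in lborel. (\<lambda>n. (norm (corr_op D (F n) y - corr_op D f y))\<^sup>2) \<longlonglongrightarrow> 0"
      using lim by simp
    have op_f_le: "norm (corr_op D f y) \<le> M" for y
      using tendsto_norm[OF ptw[of y]] corr_op_le by (intro LIMSEQ_le_const2) auto
    have "(norm (corr_op D (F n) y - corr_op D f y))\<^sup>2 \<le> (M + M)\<^sup>2 * indicator (cball 0 (q + R)) y" for n y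
    proof (cases "norm y > q + R")
      case False
      have "norm (corr_op D (F n) y - corr_op D f y) \<le> M + M"
        using norm_triangle_ineq4[of "corr_op D (F n) y" "corr_op D f y"] corr_op_le[of n y] op_f_le[of y] by linarith
      from power_mono[OF this, of 2] False show ?thesis by simp
    qed (simp add: corr_op_support[OF F] corr_op_support[OF f])
    then show "AE y in lborel. norm ((norm (corr_op D (F n) y - corr_op D f y))\<^sup>2)
        \<le> (M + M)\<^sup>2 * indicator (cball 0 (q + R)) y" for n
      by auto
  qed auto
  then have "(\<lambda>n. sqrt (LINT y|lborel. (norm (corr_op D (F n) y - corr_op D f y))\<^sup>2)) \<longlonglongrightarrow> sqrt 0"
    by (intro tendsto_real_sqrt) simp
  then have "(\<lambda>n. norm (abs_L2 (corr_op D (F n)) - abs_L2 (corr_op D f))) \<longlonglongrightarrow> 0"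
    by (simp add: L2_ops norm_abs_L2 L2_norm_def opF opf)
  then have strong: "(\<lambda>n. abs_L2 (corr_op D (F n))) \<longlonglongrightarrow> abs_L2 (corr_op D f)"
    using tendsto_norm_zero_iff LIM_zero_cancel by blast
  have weak': "(\<lambda>n. abs_L2 (F n) \<bullet> h) \<longlonglongrightarrow> abs_L2 f \<bullet> h" for h
    using weak by (cases h) (simp add: weakly_tendsto_def inner_abs_L2 F' f')
  have "(\<lambda>n. abs_L2 (F n) \<bullet> abs_L2 (corr_op D (F n))) \<longlonglongrightarrow> abs_L2 f \<bullet> abs_L2 (corr_op D f)"
    by (rule tendsto_inner_weak_strong[OF _ weak' strong, of B]) (simp add: norm_abs_L2 F' bdd)
  then show ?thesis
    by (simp add: inner_abs_L2 F' f' opF opf inner_W_eq_inner_corr_op[OF F]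
        inner_W_eq_inner_corr_op[OF f])
qed

end

end

section \<open>The transmission cross-coefficient and translated Fourier transforms\<close>

lemma chi_measurable [measurable (raw)]:
  assumes [measurable]: "z \<in> borel_measurable M" "v \<in> borel_measurable M"
  shows "(\<lambda>x. chi lam Cs (z x) (v x)) \<in> borel_measurable M"
  unfolding chi_def by measurable

lemma phase_measurable [measurable (raw)]:
  assumes [measurable]: "z \<in> borel_measurable M" "v \<in> borel_measurable M"
  shows "(\<lambda>x. phase lam Cs (z x) (v x)) \<in> borel_measurable M"
  unfolding phase_def by measurable

lemma norm_phase [simp]: "norm (phase lam Cs z v) = 1"
  by (simp add: phase_def)

lemma TCC_measurable:
  assumes [measurable]: "s \<in> borel_measurable borel" "f \<in> borel_measurable borel"
  shows "(\<lambda>z. TCC lam Cs amax s f Z (fst z) (snd z)) \<in> borel_measurable (borel \<Otimes>\<^sub>M borel)"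
proof -
  have [measurable]: "aperture lam amax \<in> sets borel"
    unfolding aperture_def by measurable
  show ?thesis unfolding TCC_def by measurable
qed

lemma norm_TCC_le:
  assumes s: "integrable lborel s" and f: "integrable lborel f"
  shows "norm (TCC lam Cs amax s f Z v w) \<le> (LINT u|lborel. \<bar>s u\<bar>) * (LINT Z'|lborel. \<bar>f Z'\<bar>)"
proof -
  let ?F = "\<lambda>Z' u. of_real (s u) * of_real (f Z') * phase lam Cs (Z + Z') (v + u)
    * cnj (phase lam Cs (Z + Z') (w + u))"
  let ?S = "LINT u|lborel. \<bar>s u\<bar>"
  have [measurable]: "s \<in> borel_measurable borel" "f \<in> borel_measurable borel"
    using borel_measurable_integrable[OF s] borel_measurable_integrable[OF f] by simp_all
  have inner: "norm (LINT u|lborel. ?F Z' u) \<le> ?S * \<bar>f Z'\<bar>" for Z'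
  proof -
    have "norm (LINT u|lborel. ?F Z' u) \<le> (LINT u|lborel. norm (?F Z' u))"
      by (rule integral_norm_bound)
    then show ?thesis by (simp add: norm_mult)
  qed
  have "norm (LINT Z'|lborel. LINT u|lborel. ?F Z' u)
      \<le> (LINT Z'|lborel. norm (LINT u|lborel. ?F Z' u))"
    by (rule integral_norm_bound)
  also have "\<dots> \<le> (LINT Z'|lborel. ?S * \<bar>f Z'\<bar>)"
  proof (rule integral_mono')
    show "integrable lborel (\<lambda>Z'. ?S * \<bar>f Z'\<bar>)" using f by auto
  qed (use inner in auto)
  finally have le: "norm (LINT Z'|lborel. LINT u|lborel. ?F Z' u) \<le> ?S * (LINT Z'|lborel. \<bar>f Z'\<bar>)"
    by simp
  have "norm (TCC lam Cs amax s f Z v w) \<le> norm (LINT Z'|lborel. LINT u|lborel. ?F Z' u)"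
    unfolding TCC_def norm_mult by (auto simp: indicator_def)
  with le show ?thesis by linarith
qed

lemma fourier_measurable:
  assumes [measurable]: "h \<in> borel_measurable borel"
  shows "fourier h \<in> borel_measurable borel"
  unfolding fourier_def by measurable

lemma norm_fourier_le: "norm (fourier h x) \<le> (LINT y|lborel. norm (h y))"
proof -
  have "norm (fourier h x) \<le> (LINT y|lborel. norm (h y * exp (- 2 * of_real pi * \<i> * of_real (x \<bullet> y))))"
    unfolding fourier_def by (rule integral_norm_bound)
  then show ?thesis by (simp add: norm_mult)
qed

lemma fourier_translate:
  assumes [measurable]: "h \<in> borel_measurable borel"
  shows "fourier (\<lambda>y. h (y + t)) x = exp (2 * of_real pi * \<i> * of_real (x \<bullet> t)) * fourier h x"
proof -
  let ?e = "\<lambda>y. exp (- 2 * of_real pi * \<i> * of_real (x \<bullet> y)) :: complex"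
  have e: "?e y = exp (2 * of_real pi * \<i> * of_real (x \<bullet> t)) * ?e (t + y)" for y
    by (simp add: exp_add[symmetric] inner_add_right algebra_simps)
  have "fourier (\<lambda>y. h (y + t)) x
      = (LINT y|lborel. exp (2 * of_real pi * \<i> * of_real (x \<bullet> t)) * (h (t + y) * ?e (t + y)))"
    unfolding fourier_def
    by (intro Bochner_Integration.integral_cong refl, subst e) (simp add: ac_simps)
  also have "\<dots> = exp (2 * of_real pi * \<i> * of_real (x \<bullet> t)) * fourier h x"
    unfolding fourier_def using lborel_integral_translate(1)[of "\<lambda>y. h y * ?e y" t] by simp
  finally show ?thesis .
qed

text \<open>The translated transforms differ from \<open>fourier h\<close> by a factor of modulus one that depends continuously on
  the translation.\<close>
lemma inner_fourier_translate_continuous: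
  fixes D :: "'a::euclidean_space \<Rightarrow> complex"
  assumes h: "integrable lborel h" and D: "integrable lborel D" and t: "t \<longlonglongrightarrow> t0"
  shows "(\<lambda>n. LINT x|lborel. fourier (\<lambda>y. h (y + t n)) x \<bullet> D x)
    \<longlonglongrightarrow> (LINT x|lborel. fourier (\<lambda>y. h (y + t0)) x \<bullet> D x)"
proof (rule integral_dominated_convergence)
  have [measurable]: "h \<in> borel_measurable borel" "D \<in> borel_measurable borel"
    using borel_measurable_integrable[OF h] borel_measurable_integrable[OF D] by simp_all
  have [measurable]: "fourier (\<lambda>y. h (y + c)) \<in> borel_measurable borel" for c
    by (rule fourier_measurable) measurable
  show "(\<lambda>x. fourier (\<lambda>y. h (y + t0)) x \<bullet> D x) \<in> borel_measurable lborel" by measurable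
  show "(\<lambda>x. fourier (\<lambda>y. h (y + t n)) x \<bullet> D x) \<in> borel_measurable lborel" for n by measurable
  show "integrable lborel (\<lambda>x. (LINT y|lborel. norm (h y)) * norm (D x))" using D by auto
  show "AE x in lborel. (\<lambda>n. fourier (\<lambda>y. h (y + t n)) x \<bullet> D x)
      \<longlonglongrightarrow> fourier (\<lambda>y. h (y + t0)) x \<bullet> D x"
    by (intro AE_I2, subst (1 2) fourier_translate) (auto intro!: tendsto_intros t)
  have "norm (fourier (\<lambda>y. h (y + t n)) x \<bullet> D x) \<le> (LINT y|lborel. norm (h y)) * norm (D x)" for n x
  proof -
    have "norm (fourier (\<lambda>y. h (y + t n)) x) = norm (fourier h x)"
      by (subst fourier_translate) (auto simp: norm_mult)
    then show ?thesis
      using Cauchy_Schwarz_ineq2[of "fourier (\<lambda>y. h (y + t n)) x" "D x"]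
        mult_right_mono[OF norm_fourier_le[of h x] norm_ge_zero[of "D x"]] by simp
  qed
  then show "AE x in lborel. norm (fourier (\<lambda>y. h (y + t n)) x \<bullet> D x)
      \<le> (LINT y|lborel. norm (h y)) * norm (D x)" for n by simp
qed

lemma compact_component_product:
  fixes K :: "'a::euclidean_space set"
  assumes "compact K" shows "compact {t :: 'a^'n::finite. \<forall>j. t $ j \<in> K}"
proof -
  obtain B where B: "\<And>x. x \<in> K \<Longrightarrow> norm x \<le> B"
    using compact_imp_bounded[OF assms] bounded_iff by blast
  have "norm t \<le> (\<Sum>j\<in>(UNIV :: 'n set). B)" if "\<forall>j. t $ j \<in> K" for t :: "'a^'n"
  proof -
    have "norm t \<le> (\<Sum>j\<in>UNIV. norm (t $ j))"
      unfolding norm_vec_def by (rule L2_set_le_sum) auto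
    also have "\<dots> \<le> (\<Sum>j\<in>(UNIV :: 'n set). B)" using that B by (intro sum_mono) auto
    finally show ?thesis .
  qed
  then have "bounded {t :: 'a^'n. \<forall>j. t $ j \<in> K}" by (auto simp: bounded_iff)
  moreover have "closed {t :: 'a^'n. \<forall>j. t $ j \<in> K}"
    by (intro closed_Collect_all closed_vimage[unfolded vimage_def] compact_imp_closed[OF assms]
        continuous_intros)
  ultimately show ?thesis by (simp add: compact_eq_bounded_closed)
qed

text \<open>The convexity inequality behind weak lower semicontinuity of the norm: the left-hand side is
  affine in \<open>x\<close>, so it passes to weak limits.\<close>
lemma norm_power2_ge_tangent: "2 * (x \<bullet> y) - (norm y)\<^sup>2 \<le> (norm x)\<^sup>2"
  for x y :: "'a::real_inner"
  using inner_ge_zero[of "x - y"]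
  by (simp add: power2_norm_eq_inner inner_diff inner_commute)

section \<open>Lower semicontinuity of the functional and existence of a minimizer\<close>

lemma E_data_nonneg: "0 \<le> E_data lam Cs amax s f g Z \<Psi> t"
  unfolding E_data_def by (intro mult_nonneg_nonneg sum_nonneg) auto

lemma aperture_eq_ball: "aperture lam amax = ball 0 (amax / lam)"
  by (auto simp: aperture_def)

lemma bounded_kernel_TCC:
  assumes s: "integrable lborel s" and f: "integrable lborel f"
  shows "bounded_kernel (TCC lam Cs amax s f Z)
    ((LINT u|lborel. \<bar>s u\<bar>) * (LINT z|lborel. \<bar>f z\<bar>))"
  using borel_measurable_integrable[OF s] borel_measurable_integrable[OF f]
  by unfold_locales (auto intro!: TCC_measurable norm_TCC_le s f)

context
  fixes lam Cs amax :: real and s :: "real^2 \<Rightarrow> real" and f :: "real \<Rightarrow> real"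
    and g :: "real^2 \<Rightarrow> real" and Z :: real
  assumes lam: "lam > 0" and amax: "amax > 0"
    and s: "integrable lborel s" and f: "integrable lborel f" and g: "integrable lborel g"
    and band: "closure (support_on UNIV (fourier (\<lambda>x. of_real (g x))))
               \<subseteq> closure ((\<lambda>v. 2 *\<^sub>R v) ` aperture lam amax)"
begin

private abbreviation "residual \<Psi> t \<equiv> (\<lambda>x.
    weighted_cross_correlation (TCC lam Cs amax s f Z) \<Psi> \<Psi> x
    - fourier (\<lambda>y. of_real (g (y + t))) x)"

interpretation bounded_kernel "TCC lam Cs amax s f Z"
    "(LINT u|lborel. \<bar>s u\<bar>) * (LINT z|lborel. \<bar>f z\<bar>)"
  using s f by (rule bounded_kernel_TCC)

private lemma g_measurable [measurable]: "g \<in> borel_measurable borel"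
  using borel_measurable_integrable[OF g] by simp

private lemma fourier_shift:
  "fourier (\<lambda>y. of_real (g (y + t))) x
    = exp (2 * of_real pi * \<i> * of_real (x \<bullet> t)) * fourier (\<lambda>y. of_real (g y)) x"
  using fourier_translate[of "\<lambda>y. of_real (g y)" t x] by simp

private lemma fourier_support:
  assumes "norm x > 2 * (amax / lam)"
  shows "fourier (\<lambda>y. of_real (g (y + t))) x = 0"
proof -
  have "(\<lambda>v. 2 *\<^sub>R v) ` aperture lam amax \<subseteq> cball 0 (2 * (amax / lam))"
    by (auto simp: aperture_def)
  then have "closure ((\<lambda>v. 2 *\<^sub>R v) ` aperture lam amax) \<subseteq> cball 0 (2 * (amax / lam))"
    by (intro closure_minimal) auto
  then have "x \<notin> support_on UNIV (fourier (\<lambda>y. of_real (g y)))"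
    using band closure_subset assms by (fastforce simp: subset_iff)
  then show ?thesis by (simp add: fourier_shift support_on_def)
qed

text \<open>Boundedness and bounded support qualify a residual as the test function \<open>D\<close> of
  \<open>inner_W_weakly_continuous\<close>. Autocorrelations of functions on the aperture live on the aperture scaled by
  two, which is also where the data are supported.\<close>
lemma residual_regular:
  assumes \<Psi>: "\<Psi> \<in> L2_space (aperture lam amax)"
  shows residual_measurable: "residual \<Psi> t \<in> borel_measurable borel"
    and residual_bounded: "norm (residual \<Psi> t x)
      \<le> 2 * ((LINT u|lborel. \<bar>s u\<bar>) * (LINT z|lborel. \<bar>f z\<bar>)) * (L2_norm \<Psi>)\<^sup>2
         + (LINT y|lborel. \<bar>g y\<bar>)"
    and residual_support: "norm x > 2 * (amax / lam) \<Longrightarrow> residual \<Psi> t x = 0"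
    and residual_in_L2: "residual \<Psi> t \<in> L2_space UNIV"
proof -
  note \<Psi>' = \<Psi>[unfolded aperture_eq_ball]
  have [measurable]: "\<Psi> \<in> borel_measurable borel" using L2_spaceD[OF \<Psi>] by simp
  have [measurable]: "fourier (\<lambda>y. of_real (g (y + t))) \<in> borel_measurable borel"
    by (rule fourier_measurable) measurable
  show meas: "residual \<Psi> t \<in> borel_measurable borel" by measurable
  show bd: "norm (residual \<Psi> t x)
      \<le> 2 * ((LINT u|lborel. \<bar>s u\<bar>) * (LINT z|lborel. \<bar>f z\<bar>)) * (L2_norm \<Psi>)\<^sup>2
         + (LINT y|lborel. \<bar>g y\<bar>)" for x
  proof -
    have "norm (fourier (\<lambda>y. of_real (g (y + t))) x) \<le> (LINT y|lborel. \<bar>g y\<bar>)"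
      using norm_fourier_le[of "\<lambda>y. of_real (g y)" x] by (simp add: fourier_shift norm_mult)
    moreover have "norm (W \<Psi> x)
        \<le> 2 * ((LINT u|lborel. \<bar>s u\<bar>) * (LINT z|lborel. \<bar>f z\<bar>)) * (L2_norm \<Psi>)\<^sup>2"
      by (rule W_bounded[OF L2_space_mono[OF \<Psi>]]) simp
    ultimately show ?thesis
      by (intro order_trans[OF norm_triangle_ineq4] add_mono)
  qed
  show supp: "residual \<Psi> t x = 0" if "norm x > 2 * (amax / lam)" for x
    using W_support[OF \<Psi>', of x] fourier_support[OF that] that by simp
  show "residual \<Psi> t \<in> L2_space UNIV"
    by (rule L2_space_bounded_support[OF meas bd supp])
qed

text \<open>The test function is the residual of the limit itself, because this is where the tangent inequality for
  the squared norm is taken.\<close>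
lemma residual_weakly_continuous:
  assumes F: "\<And>n. F n \<in> L2_space (aperture lam amax)" and h: "h \<in> L2_space (aperture lam amax)"
    and bdd: "\<And>n. L2_norm (F n) \<le> B" and weak: "weakly_tendsto F h" and t: "t \<longlonglongrightarrow> t0"
  shows "(\<lambda>n. abs_L2 (residual (F n) (t n)) \<bullet> abs_L2 (residual h t0))
    \<longlonglongrightarrow> (norm (abs_L2 (residual h t0)))\<^sup>2"
proof -
  note F' = F[unfolded aperture_eq_ball] and h' = h[unfolded aperture_eq_ball]
  let ?D = "residual h t0"
  note D = residual_in_L2[OF h, of t0]
  have D1: "integrable lborel ?D"
    by (rule L2_space_bounded_set_imp_L1(1)[of _ "2 * (amax / lam) + 1"], unfold L2_space_def)
       (use D residual_support[OF h, of _ t0] in \<open>auto simp: L2_space_def\<close>)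
  have split: "abs_L2 (residual \<Psi> u) \<bullet> abs_L2 ?D
      = (LINT x|lborel. W \<Psi> x \<bullet> ?D x) - (LINT x|lborel. fourier (\<lambda>y. of_real (g (y + u))) x \<bullet> ?D x)"
    if \<Psi>: "\<Psi> \<in> L2_space (aperture lam amax)" for \<Psi> u
  proof -
    have [measurable]: "\<Psi> \<in> borel_measurable borel" using L2_spaceD[OF \<Psi>] by simp
    have mf: "fourier (\<lambda>y. of_real (g (y + u))) \<in> borel_measurable borel"
      by (rule fourier_measurable) measurable
    have WL: "W \<Psi> \<in> L2_space UNIV"
    proof (rule L2_space_bounded_support[OF _ W_bounded])
      show "\<Psi> \<in> L2_space UNIV" using L2_space_mono[OF \<Psi>] by blast
      show "W \<Psi> x = 0" if "norm x > 2 * (amax / lam)" for x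
        using W_support[OF \<Psi>[unfolded aperture_eq_ball]] that by simp
    qed measurable
    have FL: "fourier (\<lambda>y. of_real (g (y + u))) \<in> L2_space UNIV"
      by (rule L2_space_bounded_support[OF mf norm_fourier_le fourier_support])
    show ?thesis
      unfolding inner_abs_L2[OF residual_in_L2[OF \<Psi>] D] inner_diff_left
      by (rule Bochner_Integration.integral_diff) (intro integrable_inner_L2 WL FL D)+
  qed
  have "(\<lambda>n. (LINT x|lborel. W (F n) x \<bullet> ?D x)
        - (LINT x|lborel. fourier (\<lambda>y. of_real (g (y + t n))) x \<bullet> ?D x))
      \<longlonglongrightarrow> (LINT x|lborel. W h x \<bullet> ?D x)
        - (LINT x|lborel. fourier (\<lambda>y. of_real (g (y + t0))) x \<bullet> ?D x)"
    using inner_W_weakly_continuous[OF residual_measurable[OF h, of t0] residual_bounded[OF h]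
        residual_support[OF h] F' h' bdd weak]
      inner_fourier_translate_continuous[of "\<lambda>y. of_real (g y)", OF _ D1 t] g
    by (intro tendsto_diff) auto
  then show ?thesis
    unfolding split[OF F, symmetric] split[OF h, symmetric] power2_norm_eq_inner .
qed

end

text \<open>Each squared norm in the functional is bounded below by its tangent at the limit. The tangents
  converge to the value at the limit by weak continuity, so the limit \<open>m\<close> of the functional is at least
  that value.\<close>
theorem E_reg_weakly_lower_semicontinuous:
  fixes g :: "'n::finite \<Rightarrow> real^2 \<Rightarrow> real"
  assumes lam: "lam > 0" and amax: "amax > 0" and \<alpha>: "\<alpha> > 0"
    and s: "integrable lborel s" and f: "integrable lborel f"
    and g: "\<And>j. integrable lborel (g j)"
    and band: "\<And>j. closure (support_on UNIV (fourier (\<lambda>x. of_real (g j x))))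
               \<subseteq> closure ((\<lambda>v. 2 *\<^sub>R v) ` aperture lam amax)"
    and M: "\<Psi>M \<in> L2_space (aperture lam amax)"
    and F: "\<And>n. F n \<in> L2_space (aperture lam amax)" and h: "h \<in> L2_space (aperture lam amax)"
    and bdd: "\<And>n. L2_norm (F n) \<le> B" and weak: "weakly_tendsto F h" and t: "t \<longlonglongrightarrow> t0"
    and E: "(\<lambda>n. E_reg lam Cs amax s f g Z \<Psi>M \<alpha> (F n) (t n)) \<longlonglongrightarrow> m"
  shows "E_reg lam Cs amax s f g Z \<Psi>M \<alpha> h t0 \<le> m"
proof -
  define U where "U j \<Psi> u = abs_L2 (\<lambda>x.
      weighted_cross_correlation (TCC lam Cs amax s f (Z j)) \<Psi> \<Psi> x
      - fourier (\<lambda>y. of_real (g j (y + u $ j))) x)" for j \<Psi> and u :: "(real^2)^'n"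
  define P where "P \<Psi> = abs_L2 (\<lambda>x. \<Psi> x - \<Psi>M x)" for \<Psi>
  have univ: "\<Psi> \<in> L2_space UNIV" if "\<Psi> \<in> L2_space (aperture lam amax)" for \<Psi> :: "real^2 \<Rightarrow> complex"
    using L2_space_mono[OF that] by blast
  have E_eq: "E_reg lam Cs amax s f g Z \<Psi>M \<alpha> \<Psi> u
      = 1 / real CARD('n) * (\<Sum>j\<in>UNIV. (norm (U j \<Psi> u))\<^sup>2) + \<alpha> * (norm (P \<Psi>))\<^sup>2"
    if \<Psi>: "\<Psi> \<in> L2_space (aperture lam amax)" for \<Psi> u
    unfolding E_reg_def E_data_def U_def P_def
    using residual_in_L2[OF lam amax s f g band \<Psi>] L2_space_diff[OF univ[OF \<Psi>] univ[OF M]]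
    by (simp add: norm_abs_L2)
  have U: "(\<lambda>n. U j (F n) (t n) \<bullet> U j h t0) \<longlonglongrightarrow> (norm (U j h t0))\<^sup>2" for j
    unfolding U_def
    by (rule residual_weakly_continuous[OF lam amax s f g band F h bdd weak])
       (rule tendsto_vec_nth[OF t])
  have P_eq: "P \<Psi> = abs_L2 \<Psi> - abs_L2 \<Psi>M" if "\<Psi> \<in> L2_space (aperture lam amax)" for \<Psi>
    unfolding P_def by (simp add: L2_ops univ[OF that] univ[OF M])
  have "(\<lambda>n. abs_L2 (F n) \<bullet> P h) \<longlonglongrightarrow> abs_L2 h \<bullet> P h"
    using weak by (cases "P h") (simp add: weakly_tendsto_def inner_abs_L2 univ F h)
  from tendsto_diff[OF this tendsto_const[of "abs_L2 \<Psi>M \<bullet> P h"]]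
  have P: "(\<lambda>n. P (F n) \<bullet> P h) \<longlonglongrightarrow> (norm (P h))\<^sup>2"
    unfolding power2_norm_eq_inner inner_diff_left[symmetric] P_eq[OF F, symmetric]
      P_eq[OF h, symmetric] .
  have "(\<lambda>n. 1 / real CARD('n) * (\<Sum>j\<in>UNIV. 2 * (U j (F n) (t n) \<bullet> U j h t0) - (norm (U j h t0))\<^sup>2)
        + \<alpha> * (2 * (P (F n) \<bullet> P h) - (norm (P h))\<^sup>2))
      \<longlonglongrightarrow> 1 / real CARD('n) * (\<Sum>j\<in>UNIV. 2 * (norm (U j h t0))\<^sup>2 - (norm (U j h t0))\<^sup>2)
        + \<alpha> * (2 * (norm (P h))\<^sup>2 - (norm (P h))\<^sup>2)"
    by (intro tendsto_intros U P)
  then have "1 / real CARD('n) * (\<Sum>j\<in>UNIV. 2 * (norm (U j h t0))\<^sup>2 - (norm (U j h t0))\<^sup>2)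
        + \<alpha> * (2 * (norm (P h))\<^sup>2 - (norm (P h))\<^sup>2) \<le> m"
  proof (rule LIMSEQ_le[OF _ E], intro exI[of _ 0] allI impI)
    fix n
    show "1 / real CARD('n) * (\<Sum>j\<in>UNIV. 2 * (U j (F n) (t n) \<bullet> U j h t0) - (norm (U j h t0))\<^sup>2)
        + \<alpha> * (2 * (P (F n) \<bullet> P h) - (norm (P h))\<^sup>2) \<le> E_reg lam Cs amax s f g Z \<Psi>M \<alpha> (F n) (t n)"
      unfolding E_eq[OF F]
      by (intro add_mono mult_left_mono sum_mono norm_power2_ge_tangent) (use \<alpha> in auto)
  qed
  then show ?thesis unfolding E_eq[OF h] by simp
qed

theorem theorem4p2:
  fixes lam Cs amax r \<alpha> :: real
    and s :: "real^2 \<Rightarrow> real" and f :: "real \<Rightarrow> real"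
    and g :: "'n::finite \<Rightarrow> real^2 \<Rightarrow> real" and Z :: "'n \<Rightarrow> real"
    and \<Psi>M :: "real^2 \<Rightarrow> complex"
  assumes "lam > 0" and "amax > 0" and "r > 0" and "\<alpha> > 0"
    and "probability_density s" and "probability_density f"
    and "\<And>j. integrable lborel (g j)"
    and "\<And>j. g j \<in> L2_space UNIV"
    and "\<And>j. AE x in lborel. 0 \<le> g j x"
    and "\<And>j. closure (support_on UNIV (fourier (\<lambda>x. of_real (g j x))))
               \<subseteq> closure ((\<lambda>v. 2 *\<^sub>R v) ` aperture lam amax)"
    and "\<Psi>M \<in> L2_space (aperture lam amax)"
  shows "\<exists>\<Psi> \<in> L2_space (aperture lam amax). \<exists>t \<in> {t. \<forall>j. t $ j \<in> closure (ball 0 r)}.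
           E_reg lam Cs amax s f g Z \<Psi>M \<alpha> \<Psi> t =
           (INF (\<Phi>, t') \<in> L2_space (aperture lam amax) \<times> {t. \<forall>j. t $ j \<in> closure (ball 0 r)}.
              E_reg lam Cs amax s f g Z \<Psi>M \<alpha> \<Phi> t')"
proof -
  note M = \<open>\<Psi>M \<in> L2_space (aperture lam amax)\<close> and \<alpha> = \<open>\<alpha> > 0\<close>
  define S where "S = (L2_space (aperture lam amax) :: (real^2 \<Rightarrow> complex) set)"
  define K where "K = {t :: (real^2)^'n. \<forall>j. t $ j \<in> closure (ball 0 r)}"
  define E where "E = E_reg lam Cs amax s f g Z \<Psi>M \<alpha>"
  define m where "m = (INF (\<Phi>, t') \<in> S \<times> K. E \<Phi> t')"
  have E_ge: "\<alpha> * (L2_norm (\<lambda>x. \<Phi> x - \<Psi>M x))\<^sup>2 \<le> E \<Phi> u" for \<Phi> u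
    unfolding E_def E_reg_def using E_data_nonneg by simp
  have "0 \<le> E \<Phi> u" for \<Phi> u
    using E_ge[of \<Phi> u] \<alpha> by (auto intro: order_trans[rotated])
  then have bdd: "bdd_below ((\<lambda>(\<Phi>, t'). E \<Phi> t') ` (S \<times> K))"
    by (intro bdd_belowI2[of _ 0]) auto
  have m_le: "m \<le> E \<Phi> u" if "\<Phi> \<in> S" "u \<in> K" for \<Phi> u
    unfolding m_def using cINF_lower[OF bdd, of "(\<Phi>, u)"] that by simp
  have K0: "0 \<in> K" using \<open>r > 0\<close> closure_subset[of "ball (0::real^2) r"] by (auto simp: K_def)
  have "\<exists>\<Phi> u. \<Phi> \<in> S \<and> u \<in> K \<and> E \<Phi> u < m + 1 / real (Suc n)" for n
  proof -
    have "Inf ((\<lambda>(\<Phi>, t'). E \<Phi> t') ` (S \<times> K)) < m + 1 / real (Suc n)" unfolding m_def by simp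
    from cInf_lessD[OF _ this] show ?thesis using M K0 by (auto simp: S_def)
  qed
  then obtain \<Phi> u where \<Phi>: "\<And>n. \<Phi> n \<in> S" and u: "\<And>n. u n \<in> K"
    and less: "\<And>n. E (\<Phi> n) (u n) < m + 1 / real (Suc n)"
    by metis
  have univ: "\<Psi> \<in> L2_space UNIV" if "\<Psi> \<in> S" for \<Psi>
    using L2_space_mono that unfolding S_def by blast
  have bound: "L2_norm (\<Phi> n) \<le> sqrt ((m + 1) / \<alpha>) + L2_norm \<Psi>M" for n
  proof -
    have "1 / real (Suc n) \<le> 1" by simp
    then have "\<alpha> * (L2_norm (\<lambda>x. \<Phi> n x - \<Psi>M x))\<^sup>2 \<le> m + 1"
      using E_ge[of "\<Phi> n" "u n"] less[of n] by linarith
    then have "(L2_norm (\<lambda>x. \<Phi> n x - \<Psi>M x))\<^sup>2 \<le> (m + 1) / \<alpha>"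
      using \<alpha> by (simp add: field_simps)
    then have "L2_norm (\<lambda>x. \<Phi> n x - \<Psi>M x) \<le> sqrt ((m + 1) / \<alpha>)"
      by (rule real_le_rsqrt)
    moreover have "norm (abs_L2 (\<Phi> n)) \<le> norm (abs_L2 (\<Phi> n) - abs_L2 \<Psi>M) + norm (abs_L2 \<Psi>M)"
      using norm_triangle_ineq[of "abs_L2 (\<Phi> n) - abs_L2 \<Psi>M" "abs_L2 \<Psi>M"] by simp
    ultimately show ?thesis
      using univ[OF \<Phi>] univ[of \<Psi>M] M by (simp add: S_def L2_ops norm_abs_L2)
  qed
  have "aperture lam amax \<in> sets borel" by (simp add: aperture_eq_ball)
  from L2_bounded_imp_weakly_convergent_subsequence[of \<Phi>, OF \<Phi>[unfolded S_def] bound this]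
  obtain p \<Psi> where p: "strict_mono p" and \<Psi>: "\<Psi> \<in> S" and weak: "weakly_tendsto (\<Phi> \<circ> p) \<Psi>"
    by (elim exE conjE) (simp add: that S_def)
  have "seq_compact K"
    unfolding K_def by (intro compact_imp_seq_compact compact_component_product) simp
  then obtain t q where t: "t \<in> K" and q: "strict_mono q" and lim: "((u \<circ> p) \<circ> q) \<longlonglongrightarrow> t"
    by (rule seq_compactE[of K "u \<circ> p"]) (simp_all add: u)
  have E_lim: "(\<lambda>n. E (\<Phi> n) (u n)) \<longlonglongrightarrow> m"
  proof (rule tendsto_sandwich[of "\<lambda>_. m" _ _ "\<lambda>n. m + 1 / real (Suc n)"])
    show "(\<lambda>n. m + 1 / real (Suc n)) \<longlonglongrightarrow> m"
      using tendsto_add[OF tendsto_const LIMSEQ_inverse_real_of_nat, of m]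
      by (simp add: inverse_eq_divide)
  qed (use m_le \<Phi> u less in \<open>auto intro!: always_eventually less_imp_le\<close>)
  have "strict_mono (p \<circ> q)" using p q by (rule strict_mono_o)
  from LIMSEQ_subseq_LIMSEQ[OF E_lim this]
  have E_lim': "(\<lambda>n. E (\<Phi> (p (q n))) (u (p (q n)))) \<longlonglongrightarrow> m" by (simp add: o_def)
  have weak': "weakly_tendsto (\<lambda>n. \<Phi> (p (q n))) \<Psi>"
    unfolding weakly_tendsto_def
  proof
    fix h :: "real^2 \<Rightarrow> complex" assume "h \<in> L2_space UNIV"
    from LIMSEQ_subseq_LIMSEQ[OF bspec[OF weak[unfolded weakly_tendsto_def] this] q]
    show "(\<lambda>n. LINT x|lborel. \<Phi> (p (q n)) x \<bullet> h x) \<longlonglongrightarrow> (LINT x|lborel. \<Psi> x \<bullet> h x)"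
      by (simp add: o_def)
  qed
  have "E \<Psi> t \<le> m"
    unfolding E_def
  proof (rule E_reg_weakly_lower_semicontinuous[OF assms(1,2,4) _ _ assms(7,10,11)])
    show "integrable lborel s" "integrable lborel f"
      using \<open>probability_density s\<close> \<open>probability_density f\<close> by (auto simp: probability_density_def)
    show "(\<lambda>n. u (p (q n))) \<longlonglongrightarrow> t" using lim by (simp add: o_def)
    show "weakly_tendsto (\<lambda>n. \<Phi> (p (q n))) \<Psi>" by (rule weak')
    show "(\<lambda>n. E_reg lam Cs amax s f g Z \<Psi>M \<alpha> (\<Phi> (p (q n))) (u (p (q n)))) \<longlonglongrightarrow> m"
      using E_lim' unfolding E_def .
    show "L2_norm (\<Phi> (p (q n))) \<le> sqrt ((m + 1) / \<alpha>) + L2_norm \<Psi>M" for n by (rule bound)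
    show "\<Phi> (p (q n)) \<in> L2_space (aperture lam amax)" for n using \<Phi> by (simp add: S_def)
    show "\<Psi> \<in> L2_space (aperture lam amax)" using \<Psi> by (simp add: S_def)
  qed
  then have "E \<Psi> t = m" using m_le[OF \<Psi> t] by simp
  then show ?thesis
    unfolding m_def E_def using \<Psi> t unfolding S_def K_def by blast
qed

end
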